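(* Let $k\geqslant 2$ and $d\geqslant 1$ be integers and let $F(z)=\sum_{i\geqslant 0}f(i)z^i\in\mathbb{C}[[z]]$ be a $k$-Mahler function satisfying $$a_0(z)F(z)+a_1(z)F(z^k)+\cdots+a_d(z)F(z^{k^d})=0,$$ for polynomials $a_0(z),\ldots,a_d(z)\in\mathbb{C}[z]$ with $a_d(z)$ not the zero polynomial. Set $H:=\max\{\deg a_i(z): i=0,\ldots,d\}$ and $$\kappa:=\left\lfloor \frac{H(k-1)}{k^{d+1}-2k^d+1}\right\rfloor+\left\lfloor \frac{H}{k^{d-1}(k-1)}\right\rfloor+1.$$ Let $\mathbf{M}$ be the $(1+\kappa)\times\left(1+H+\kappa\frac{k^{d+1}-1}{k-1}\right)$ matrix whose $(i,j)$-entry is $f(i+j-2)$ (for $i,j\geqslant 1$). If $\mathbf{M}$ has full rank (that is, rank equal to $1+\kappa$), then $F(z)$ is transcendental over $\mathbb{C}(z)$; otherwise $F(z)$ is (the power series expansion at $0$ of) a rational function.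
   Context: A power series $F(z)\in\mathbb{C}[[z]]$ is a $k$-Mahler function ($k\geqslant 2$ an integer) if there are an integer $d\geqslant 1$ and polynomials $a_0(z),\ldots,a_d(z)\in\mathbb{C}[z]$, with $a_d(z)$ not the zero polynomial, such that $\sum_{i=0}^d a_i(z)F(z^{k^i})=0$. No convergence assumption on $F$ is made. *)

theory Defs
  imports
    "HOL-Computational_Algebra.Computational_Algebra"
    "Jordan_Normal_Form.DL_Rank"
begin

definition mahler_equation ::
    "nat \<Rightarrow> nat \<Rightarrow> (nat \<Rightarrow> complex poly) \<Rightarrow> complex fps \<Rightarrow> bool" where
  "mahler_equation k d a F \<longleftrightarrow>
     (\<Sum>i = 0..d. fps_of_poly (a i) * fps_compose F (fps_X ^ (k ^ i))) = 0"

definition mahler_function :: "nat \<Rightarrow> complex fps \<Rightarrow> bool" where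
  "mahler_function k F \<longleftrightarrow>
     k \<ge> 2 \<and> (\<exists>d\<ge>1. \<exists>a. a d \<noteq> 0 \<and> mahler_equation k d a F)"

text \<open>The field of rational functions \<open>\<complex>(z)\<close>, embedded in the field of formal Laurent
  series by expansion at \<open>0\<close>.\<close>

definition rational_fls :: "complex fls set" where
  "rational_fls =
     {fps_to_fls (fps_of_poly p) / fps_to_fls (fps_of_poly q) | p q. q \<noteq> 0}"

definition algebraic_over :: "'a :: field set \<Rightarrow> 'a \<Rightarrow> bool" where
  "algebraic_over K x \<longleftrightarrow>
     (\<exists>P :: 'a poly. P \<noteq> 0 \<and> (\<forall>i. coeff P i \<in> K) \<and> poly P x = 0)"

definition transcendental_over :: "'a :: field set \<Rightarrow> 'a \<Rightarrow> bool" where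
  "transcendental_over K x \<longleftrightarrow> \<not> algebraic_over K x"

definition mahler_kappa :: "nat \<Rightarrow> nat \<Rightarrow> nat \<Rightarrow> nat" where
  "mahler_kappa k d H = nat (
     \<lfloor>real H * (real k - 1) / (real k ^ (d + 1) - 2 * real k ^ d + 1)\<rfloor> +
     \<lfloor>real H / (real k ^ (d - 1) * (real k - 1))\<rfloor> + 1)"

text \<open>Matrices are indexed from \<open>0\<close> here, so the entry \<open>f (i + j - 2)\<close> in the usual
  indexing from \<open>1\<close> becomes \<open>f (i + j)\<close>.\<close>

definition hankel_mat :: "nat \<Rightarrow> nat \<Rightarrow> complex fps \<Rightarrow> complex mat" where
  "hankel_mat m n F = mat m n (\<lambda>(i, j). fps_nth F (i + j))"

end

theory Submission
  imports Defs "Jordan_Normal_Form.Char_Poly" "HOL-Computational_Algebra.Field_as_Ring"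
begin

text \<open>Write \<open>\<sigma>\<close> for the substitution \<open>z \<mapsto> z\<^sup>k\<close> and \<open>\<delta>\<close> for the derivation \<open>z d/dz\<close>.

  \<^bold>\<open>Rank deficiency implies rationality.\<close> A nonzero vector in the left kernel of the Hankel matrix,
  read backwards, is a polynomial \<open>Q\<close> of degree at most \<open>\<kappa>\<close> such that \<open>Q F\<close> agrees with a polynomial
  \<open>P\<close> up to order \<open>\<kappa> + N\<close>, where \<open>N\<close> is the number of columns. Put \<open>P/Q\<close> into the functional equation
  and clear denominators: the result is a polynomial of degree less than \<open>N\<close> that vanishes at \<open>0\<close> to
  order at least \<open>N\<close>, so it is zero. Thus \<open>P/Q\<close> is a solution as well, and \<open>F - P/Q\<close> is a solution that
  vanishes at \<open>0\<close> to an order larger than any nonzero solution can (\<open>approximant_is_exact\<close>).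

  \<^bold>\<open>Rationality implies rank deficiency.\<close> Let \<open>F = p/q\<close> in lowest terms. Comparing the denominators in
  the equation bounds \<open>degree q\<close>, comparing the growth at infinity bounds \<open>degree p - degree q\<close>, and the
  two bounds are the two summands of \<open>\<kappa>\<close> (\<open>rational_lowest_terms_degrees\<close>). The coefficients of \<open>q\<close> are
  then a left kernel vector.

  \<^bold>\<open>An algebraic Mahler function is rational\<close> (\<open>algebraic_mahler_rational\<close>). Geometrically, the branch
  points outside \<open>0\<close> and \<open>\<infinity>\<close> of the field generated by the \<open>\<sigma>\<^sup>i F\<close> are closed under taking \<open>k\<close>-th
  roots, which a finite nonempty set cannot be; and a connected cover of the punctured line with a section near \<open>0\<close> is trivial. The following
  argument is an algebraic form of this that stays within power series. Let \<open>L\<close> consist of the power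
  series that are \<open>\<complex>(z)\<close>-linear combinations of monomials in the \<open>\<sigma>\<^sup>i F\<close>. It is a ring of finite rank
  \<open>m\<close>, stable under \<open>\<sigma>\<close> and \<open>\<delta>\<close>. Let \<open>W q\<close> be the set of \<open>u\<close> in \<open>L\<close> that are integral over \<open>\<complex>[z]\<close> and
  grow at infinity at most like \<open>z\<^sup>q\<close>, on all branches. Three facts are used.

  \<^item> A nonzero \<open>u\<close> in \<open>W q\<close> vanishes at \<open>0\<close> to order at most \<open>q m\<close> (\<open>subdegree_bound\<close>), so \<open>W q\<close> has
    dimension at most \<open>q m + 1\<close> over \<open>\<complex>\<close>.

  \<^item> The leading term \<open>q m\<close> is also the growth of the dimension of a free \<open>\<complex>[z]\<close>-module of rank \<open>m\<close>.
    Hence integral elements of \<open>L\<close> have coordinates, in a fixed basis, whose denominators have degree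
    bounded independently of the element (\<open>bounded_denominator\<close>). Consequently \<open>\<delta>\<close> destroys integrality
    and increases the growth only by a bounded amount.

  \<^item> If \<open>D \<sigma>\<^sup>n h\<close> is integral, with \<open>degree D\<close> small compared to \<open>k\<^sup>n\<close>, then already \<open>h\<close> is integral, and
    a bounded excess of growth disappears too (\<open>integral_le_descent\<close>).

  As \<open>\<delta> \<sigma>\<^sup>n = k\<^sup>n \<sigma>\<^sup>n \<delta>\<close>, the last two facts show \<open>\<delta> (W q) \<subseteq> W q\<close>. By finite dimension each \<open>f\<close> in
  \<open>W q\<close> satisfies \<open>\<chi>(\<delta>) f = 0\<close> for a nonzero complex polynomial \<open>\<chi>\<close>, that is, \<open>\<chi>(n) f\<^sub>n = 0\<close> for all
  \<open>n\<close>. So \<open>f\<close> is a polynomial, and all elements of \<open>L\<close> are rational.\<close>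

interpretation fps_of_poly_hom: inj_comm_ring_hom "fps_of_poly :: complex poly \<Rightarrow> complex fps"
  by unfold_locales
    (auto simp: fps_of_poly_add fps_of_poly_mult fps_of_poly_eq_iff)

interpretation map_fps_of_poly_hom: map_poly_inj_comm_ring_hom
  "fps_of_poly :: complex poly \<Rightarrow> complex fps" ..

section \<open>Homogeneous linear systems\<close>

lemma system_nontrivial_solution:
  fixes a :: "'t \<Rightarrow> nat \<Rightarrow> 'a :: idom"
  assumes "finite T" "n < card T"
  shows "\<exists>x. (\<exists>t\<in>T. x t \<noteq> 0) \<and> (\<forall>j<n. (\<Sum>t\<in>T. x t * a t j) = 0)"
  using assms
proof (induction n arbitrary: T a)
  case 0
  then obtain t where "t \<in> T" by (metis card.empty less_nat_zero_code equals0I)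
  then show ?case by (intro exI[of _ "\<lambda>_. 1"]) auto
next
  case (Suc n)
  show ?case
  proof (cases "\<forall>t\<in>T. a t n = 0")
    case True
    from Suc.IH[of T a] Suc.prems obtain x where
      "\<exists>t\<in>T. x t \<noteq> 0" "\<forall>j<n. (\<Sum>t\<in>T. x t * a t j) = 0" by auto
    with True show ?thesis by (intro exI[of _ x]) (auto simp: less_Suc_eq)
  next
    case False
    then obtain s where s: "s \<in> T" "a s n \<noteq> 0" by auto
    let ?T = "T - {s}"
    let ?b = "\<lambda>t j. a s n * a t j - a t n * a s j"
    have "finite ?T" "n < card ?T" using Suc.prems s by (auto simp: card_Diff_singleton)
    from Suc.IH[OF this, of ?b] obtain x where
      x: "\<exists>t\<in>?T. x t \<noteq> 0" "\<forall>j<n. (\<Sum>t\<in>?T. x t * ?b t j) = 0" by blast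
    define y where "y t = (if t = s then - (\<Sum>t\<in>?T. x t * a t n) else a s n * x t)" for t
    have eq: "(\<Sum>t\<in>T. y t * a t j) = (\<Sum>t\<in>?T. x t * ?b t j)" for j
    proof -
      have "(\<Sum>t\<in>T. y t * a t j) = y s * a s j + (\<Sum>t\<in>?T. y t * a t j)"
        using s Suc.prems by (subst sum.remove) auto
      also have "(\<Sum>t\<in>?T. y t * a t j) = (\<Sum>t\<in>?T. a s n * x t * a t j)"
        by (rule sum.cong) (auto simp: y_def)
      finally show ?thesis
        by (simp add: y_def algebra_simps sum_subtractf sum_distrib_left sum_distrib_right)
    qed
    have "(\<Sum>t\<in>T. y t * a t n) = 0" unfolding eq by (simp add: algebra_simps)
    moreover have "\<exists>t\<in>T. y t \<noteq> 0" using x(1) s(2) by (auto simp: y_def)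
    ultimately show ?thesis using x(2) by (intro exI[of _ y]) (auto simp: eq less_Suc_eq)
  qed
qed

section \<open>Polynomials in one indeterminate over the polynomial ring\<close>

definition bipoly_eval :: "complex poly poly \<Rightarrow> complex fps \<Rightarrow> complex fps" where
  "bipoly_eval P u = poly (map_poly fps_of_poly P) u"

lemma bipoly_eval_simps [simp]:
  "bipoly_eval 0 u = 0" "bipoly_eval 1 u = 1"
  "bipoly_eval (P + Q) u = bipoly_eval P u + bipoly_eval Q u" "bipoly_eval (P - Q) u = bipoly_eval P u - bipoly_eval Q u"
  "bipoly_eval (- P) u = - bipoly_eval P u"
  "bipoly_eval (P * Q) u = bipoly_eval P u * bipoly_eval Q u"
  "bipoly_eval (Polynomial.smult c P) u = fps_of_poly c * bipoly_eval P u"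
  "bipoly_eval (pCons c P) u = fps_of_poly c + u * bipoly_eval P u"
  by (auto simp: bipoly_eval_def hom_distribs)

lemma bipoly_eval_altdef: "degree P \<le> n \<Longrightarrow> bipoly_eval P u = (\<Sum>i\<le>n. fps_of_poly (coeff P i) * u ^ i)"
  unfolding bipoly_eval_def poly_altdef
  by (rule sum.mono_neutral_cong_left) (auto simp: coeff_eq_0)

text \<open>Weighted degree on \<open>\<complex>[z][X]\<close>, where \<open>z\<close> has weight \<open>1\<close> and \<open>X\<close> has weight \<open>q\<close>. The bound is an integer
  because the entries of the matrices below have weights that may be negative.\<close>

definition weight_le :: "nat \<Rightarrow> int \<Rightarrow> complex poly poly \<Rightarrow> bool" where
  "weight_le q w P \<longleftrightarrow> (\<forall>i. coeff P i \<noteq> 0 \<longrightarrow> int (degree (coeff P i)) + int (q * i) \<le> w)"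

lemma weight_le_0 [simp]: "weight_le q w 0"
  by (auto simp: weight_le_def)

lemma weight_le_add: "weight_le q w P \<Longrightarrow> weight_le q w Q \<Longrightarrow> weight_le q w (P + Q)"
  unfolding weight_le_def
proof (intro allI impI)
  fix i assume *: "\<forall>i. coeff P i \<noteq> 0 \<longrightarrow> int (degree (coeff P i)) + int (q * i) \<le> w"
    "\<forall>i. coeff Q i \<noteq> 0 \<longrightarrow> int (degree (coeff Q i)) + int (q * i) \<le> w"
    and nz: "coeff (P + Q) i \<noteq> 0"
  have "degree (coeff P i + coeff Q i) \<le> max (degree (coeff P i)) (degree (coeff Q i))"
    by (rule degree_add_le_max)
  with *[rule_format, of i] nz show "int (degree (coeff (P + Q) i)) + int (q * i) \<le> w"
    by (cases "coeff P i = 0"; cases "coeff Q i = 0") auto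
qed

lemma weight_le_sum: "(\<And>x. x \<in> A \<Longrightarrow> weight_le q w (f x)) \<Longrightarrow> weight_le q w (sum f A)"
  by (induction A rule: infinite_finite_induct) (auto intro: weight_le_add)

lemma weight_le_uminus: "weight_le q w P \<Longrightarrow> weight_le q w (- P)"
  by (auto simp: weight_le_def)

lemma weight_le_mult:
  assumes "weight_le q v P" "weight_le q w Q" shows "weight_le q (v + w) (P * Q)"
  unfolding weight_le_def
proof (intro allI impI)
  fix n assume nz: "coeff (P * Q) n \<noteq> 0"
  have t: "int (degree (coeff P i * coeff Q (n - i))) + int (q * n) \<le> v + w"
    if "i \<le> n" "coeff P i * coeff Q (n - i) \<noteq> 0" for i
  proof -
    have "int (degree (coeff P i)) + int (q * i) \<le> v" "int (degree (coeff Q (n-i))) + int (q * (n-i)) \<le> w"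
      using assms that by (auto simp: weight_le_def)
    moreover have "q * n = q * i + q * (n - i)" using that
      by (metis add_mult_distrib2 le_add_diff_inverse)
    ultimately show ?thesis using that by (simp add: degree_mult_eq)
  qed
  have "\<exists>i\<le>n. coeff P i * coeff Q (n - i) \<noteq> 0"
    using nz unfolding coeff_mult by (meson atMost_iff sum.neutral)
  then have nn: "int (q * n) \<le> v + w" using t by fastforce
  have "degree (coeff (P * Q) n) \<le> nat (v + w - int (q * n))"
    unfolding coeff_mult
  proof (rule degree_sum_le)
    fix i assume i: "i \<in> {..n}"
    show "degree (coeff P i * coeff Q (n - i)) \<le> nat (v + w - int (q * n))"
    proof (cases "coeff P i * coeff Q (n - i) = 0")
      case True
      then show ?thesis by (simp only: degree_0)
    next
      case False
      with t[of i] i nn show ?thesis by simp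
    qed
  qed auto
  with nn show "int (degree (coeff (P * Q) n)) + int (q * n) \<le> v + w" by linarith
qed

lemma weight_le_prod:
  "finite A \<Longrightarrow> (\<And>x. x \<in> A \<Longrightarrow> weight_le q (w x) (f x)) \<Longrightarrow> weight_le q (\<Sum>x\<in>A. w x) (\<Prod>x\<in>A. f x)"
  by (induction A rule: finite_induct) (auto intro!: weight_le_mult, simp add: weight_le_def)

section \<open>Integral power series of bounded growth\<close>

text \<open>The equation is monic in \<open>X\<close> of degree \<open>n\<close> and the coefficient of \<open>X\<^bsup>n-l\<^esup>\<close> has degree at most \<open>q l\<close>.
  So \<open>u\<close> is integral over \<open>\<complex>[z]\<close>, and all branches of \<open>u\<close> are \<open>O(z\<^sup>q)\<close> at infinity.\<close>

definition integral_le :: "nat \<Rightarrow> complex fps set" where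
  "integral_le q = {u. \<exists>P. lead_coeff P = 1 \<and> weight_le q (int (q * degree P)) P \<and> bipoly_eval P u = 0}"

interpretation bipoly_eval_hom: comm_ring_hom "\<lambda>P. bipoly_eval P u" for u
  by unfold_locales auto

text \<open>Multiplication by \<open>u\<close> maps the \<open>\<complex>[z]\<close>-module generated by the family \<open>v\<close> to itself. The generator \<open>v i\<close>
  is counted with growth \<open>w i\<close>, and multiplication by \<open>u\<close> raises the growth by at most \<open>q\<close>.\<close>

definition acts_le :: "'i set \<Rightarrow> ('i \<Rightarrow> complex fps) \<Rightarrow> ('i \<Rightarrow> int) \<Rightarrow> int \<Rightarrow> complex fps \<Rightarrow> bool" where
  "acts_le I v w q u \<longleftrightarrow> (\<exists>M.
     (\<forall>i\<in>I. u * v i = (\<Sum>j\<in>I. fps_of_poly (M i j) * v j)) \<and>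
     (\<forall>i\<in>I. \<forall>j\<in>I. M i j \<noteq> 0 \<longrightarrow> int (degree (M i j)) \<le> q + w i - w j))"

text \<open>The determinant trick: \<open>u\<close> is a root of the characteristic polynomial of a matrix of the action. In the
  Leibniz expansion the differences \<open>w i - w (p i)\<close> cancel along each permutation \<open>p\<close>, which leaves the
  weight \<open>q n\<close>.\<close>

lemma acts_le_imp_integral_le_nat:
  fixes n :: nat
  assumes nz: "\<exists>i<n. v i \<noteq> 0" and act: "acts_le {..<n} v w (int q) u"
  shows "u \<in> integral_le q"
proof -
  obtain M where M: "\<And>i. i < n \<Longrightarrow> u * v i = (\<Sum>j<n. fps_of_poly (M i j) * v j)"
    and deg: "\<And>i j. i < n \<Longrightarrow> j < n \<Longrightarrow> M i j \<noteq> 0 \<Longrightarrow> int (degree (M i j)) \<le> int q + w i - w j"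
    using act unfolding acts_le_def by blast
  define A where "A = mat n n (\<lambda>(i, j). M i j)"
  have A: "A \<in> carrier_mat n n" by (simp add: A_def)
  let ?C = "char_poly_matrix A"
  have C: "?C \<in> carrier_mat n n" using A by simp
  have C_nth: "?C $$ (i, j) = (if i = j then [:- M i j, 1:] else [:- M i j:])" if "i < n" "j < n" for i j
    using that by (auto simp: char_poly_matrix_def A_def)
  have dm: "degree (char_poly A) = n" "coeff (char_poly A) n = 1"
    using degree_monic_char_poly[OF A] by auto
  have "weight_le q (int (q * n)) (char_poly A)"
    unfolding char_poly_def det_def'[OF C]
  proof (rule weight_le_sum)
    fix p assume "p \<in> {p. p permutes {0..<n}}"
    then have p: "p permutes {0..<n}" by simp
    have ent: "weight_le q (int q + w i - w (p i)) (?C $$ (i, p i))" if i: "i \<in> {0..<n}" for i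
    proof -
      have "p i < n" using permutes_in_image[OF p] i by auto
      with i deg[of i "p i"] show ?thesis
        by (auto simp: C_nth weight_le_def coeff_pCons split: nat.splits)
    qed
    have "(\<Sum>i = 0..<n. int q + w i - w (p i)) = int (q * n)"
      using sum.permute[OF p, of w] by (simp add: sum.distrib sum_subtractf o_def)
    moreover have "weight_le q (\<Sum>i = 0..<n. int q + w i - w (p i)) (\<Prod>i = 0..<n. ?C $$ (i, p i))"
      by (rule weight_le_prod) (use ent in simp_all)
    ultimately have "weight_le q (int (q * n)) (\<Prod>i = 0..<n. ?C $$ (i, p i))" by (simp only:)
    then show "weight_le q (int (q * n)) (signof p * (\<Prod>i = 0..<n. ?C $$ (i, p i)))"
      by (auto simp: sign_def intro: weight_le_uminus)
  qed
  moreover have "bipoly_eval (char_poly A) u = 0"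
  proof -
    let ?B = "map_mat (\<lambda>P. bipoly_eval P u) ?C"
    have B: "?B \<in> carrier_mat n n" using C by simp
    have "?B *\<^sub>v vec n v = 0\<^sub>v n"
    proof (rule eq_vecI)
      fix i assume "i < dim_vec (0\<^sub>v n :: complex fps vec)"
      then have i: "i < n" by simp
      have "(?B *\<^sub>v vec n v) $ i = (\<Sum>j = 0..<n. bipoly_eval (?C $$ (i, j)) u * v j)"
        using i C by (auto simp: scalar_prod_def)
      also have "\<dots> = (\<Sum>j<n. (if j = i then u * v j else 0) - fps_of_poly (M i j) * v j)"
        by (rule sum.cong) (use i in \<open>auto simp: C_nth algebra_simps fps_of_poly_uminus\<close>)
      also have "\<dots> = 0" using i M[OF i] by (simp add: sum_subtractf)
      finally show "(?B *\<^sub>v vec n v) $ i = 0\<^sub>v n $ i" using i by simp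
    qed (use C in auto)
    moreover have "vec n v \<noteq> 0\<^sub>v n" using nz by (metis index_vec index_zero_vec(1))
    ultimately have "det ?B = 0"
      using det_0_iff_vec_prod_zero[OF B] by (metis vec_carrier)
    then show ?thesis unfolding char_poly_def by (simp add: bipoly_eval_hom.hom_det)
  qed
  ultimately show ?thesis unfolding integral_le_def using dm by auto
qed

lemma acts_le_imp_integral_le:
  assumes fin: "finite I" and nz: "\<exists>i\<in>I. v i \<noteq> 0" and act: "acts_le I v w (int q) u"
  shows "u \<in> integral_le q"
proof -
  obtain h where h: "bij_betw h {..<card I} I"
    using ex_bij_betw_nat_finite[OF fin] by (auto simp: atLeast0LessThan)
  obtain M where M: "\<And>i. i \<in> I \<Longrightarrow> u * v i = (\<Sum>j\<in>I. fps_of_poly (M i j) * v j)"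
    and deg: "\<And>i j. i \<in> I \<Longrightarrow> j \<in> I \<Longrightarrow> M i j \<noteq> 0 \<Longrightarrow> int (degree (M i j)) \<le> int q + w i - w j"
    using act unfolding acts_le_def by blast
  have hI: "h i \<in> I" if "i < card I" for i using bij_betwE[OF h] that by auto
  have "acts_le {..<card I} (v \<circ> h) (w \<circ> h) (int q) u"
    unfolding acts_le_def
  proof (intro exI[of _ "\<lambda>i j. M (h i) (h j)"] conjI ballI impI)
    fix i assume "i \<in> {..<card I}"
    then show "u * (v \<circ> h) i = (\<Sum>j<card I. fps_of_poly (M (h i) (h j)) * (v \<circ> h) j)"
      using M[OF hI, of i] sum.reindex_bij_betw[OF h, of "\<lambda>j. fps_of_poly (M (h i) j) * v j"] by simp
  qed (use deg hI in auto)
  moreover have "\<exists>i<card I. (v \<circ> h) i \<noteq> 0"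
    using nz bij_betw_imp_surj_on[OF h] by (auto simp: image_iff) (metis imageE lessThan_iff)
  ultimately show ?thesis using acts_le_imp_integral_le_nat[of "card I" "v \<circ> h"] by blast
qed

lemma acts_le_add:
  assumes "acts_le I v w q u" "acts_le I v w q u'" shows "acts_le I v w q (u + u')"
proof -
  obtain M M' where M: "\<And>i. i \<in> I \<Longrightarrow> u * v i = (\<Sum>j\<in>I. fps_of_poly (M i j) * v j)"
    "\<And>i. i \<in> I \<Longrightarrow> u' * v i = (\<Sum>j\<in>I. fps_of_poly (M' i j) * v j)"
    and deg: "\<And>i j. i \<in> I \<Longrightarrow> j \<in> I \<Longrightarrow> M i j \<noteq> 0 \<Longrightarrow> int (degree (M i j)) \<le> q + w i - w j"
      "\<And>i j. i \<in> I \<Longrightarrow> j \<in> I \<Longrightarrow> M' i j \<noteq> 0 \<Longrightarrow> int (degree (M' i j)) \<le> q + w i - w j"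
    using assms unfolding acts_le_def by blast
  show ?thesis unfolding acts_le_def
  proof (intro exI[of _ "\<lambda>i j. M i j + M' i j"] conjI ballI impI)
    fix i assume "i \<in> I"
    then show "(u + u') * v i = (\<Sum>j\<in>I. fps_of_poly (M i j + M' i j) * v j)"
      using M by (simp add: hom_distribs algebra_simps sum.distrib)
  next
    fix i j assume ij: "i \<in> I" "j \<in> I" "M i j + M' i j \<noteq> 0"
    have "degree (M i j + M' i j) \<le> max (degree (M i j)) (degree (M' i j))"
      by (rule degree_add_le_max)
    with ij deg[of i j] show "int (degree (M i j + M' i j)) \<le> q + w i - w j"
      by (cases "M i j = 0"; cases "M' i j = 0") auto
  qed
qed

lemma acts_le_mult:
  assumes fin: "finite I" and "acts_le I v w q u" "acts_le I v w q' u'" shows "acts_le I v w (q + q') (u * u')"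
proof -
  obtain M M' where M: "\<And>i. i \<in> I \<Longrightarrow> u * v i = (\<Sum>j\<in>I. fps_of_poly (M i j) * v j)"
    "\<And>i. i \<in> I \<Longrightarrow> u' * v i = (\<Sum>j\<in>I. fps_of_poly (M' i j) * v j)"
    and deg: "\<And>i j. i \<in> I \<Longrightarrow> j \<in> I \<Longrightarrow> M i j \<noteq> 0 \<Longrightarrow> int (degree (M i j)) \<le> q + w i - w j"
      "\<And>i j. i \<in> I \<Longrightarrow> j \<in> I \<Longrightarrow> M' i j \<noteq> 0 \<Longrightarrow> int (degree (M' i j)) \<le> q' + w i - w j"
    using assms unfolding acts_le_def by blast
  show ?thesis unfolding acts_le_def
  proof (intro exI[of _ "\<lambda>i j. \<Sum>l\<in>I. M' i l * M l j"] conjI ballI impI)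
    fix i assume i: "i \<in> I"
    have "(u * u') * v i = (\<Sum>l\<in>I. fps_of_poly (M' i l) * (u * v l))"
      using M(2)[OF i] by (simp add: sum_distrib_left mult_ac)
    also have "\<dots> = (\<Sum>l\<in>I. \<Sum>j\<in>I. fps_of_poly (M' i l * M l j) * v j)"
      by (rule sum.cong) (auto simp: M(1) sum_distrib_left hom_distribs mult_ac)
    also have "\<dots> = (\<Sum>j\<in>I. fps_of_poly (\<Sum>l\<in>I. M' i l * M l j) * v j)"
      by (subst sum.swap) (simp add: sum_distrib_right fps_of_poly_sum)
    finally show "(u * u') * v i = (\<Sum>j\<in>I. fps_of_poly (\<Sum>l\<in>I. M' i l * M l j) * v j)" .
  next
    fix i j assume ij: "i \<in> I" "j \<in> I" and nz: "(\<Sum>l\<in>I. M' i l * M l j) \<noteq> 0"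
    have t: "int (degree (M' i l * M l j)) \<le> q + q' + w i - w j" if "l \<in> I" "M' i l * M l j \<noteq> 0" for l
      using that ij deg[of l j] deg(2)[of i l] by (auto simp: degree_mult_eq)
    then have nn: "0 \<le> q + q' + w i - w j"
      using nz by (smt (verit, best) of_nat_0_le_iff sum.neutral)
    have "degree (\<Sum>l\<in>I. M' i l * M l j) \<le> nat (q + q' + w i - w j)"
    proof (rule degree_sum_le[OF fin])
      fix l assume "l \<in> I"
      show "degree (M' i l * M l j) \<le> nat (q + q' + w i - w j)"
      proof (cases "M' i l * M l j = 0")
        case True
        then show ?thesis by (simp only: degree_0)
      next
        case False
        with t[OF \<open>l \<in> I\<close>] show ?thesis by linarith
      qed
    qed
    then show "int (degree (\<Sum>l\<in>I. M' i l * M l j)) \<le> q + q' + w i - w j" using nn by linarith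
  qed
qed

lemma acts_le_poly:
  assumes fin: "finite I" and "degree p \<le> q" shows "acts_le I v w (int q) (fps_of_poly p)"
  unfolding acts_le_def
proof (intro exI[of _ "\<lambda>i j. if i = j then p else 0"] conjI ballI impI)
  fix i assume "i \<in> I"
  have "(\<Sum>j\<in>I. fps_of_poly (if i = j then p else 0) * v j) = (\<Sum>j\<in>I. if i = j then fps_of_poly p * v j else 0)"
    by (rule sum.cong) auto
  with \<open>i \<in> I\<close> fin show "fps_of_poly p * v i = (\<Sum>j\<in>I. fps_of_poly (if i = j then p else 0) * v j)"
    by simp
qed (use assms in \<open>auto split: if_splits\<close>)

lemma integral_le_powers_act:
  assumes "u \<in> integral_le q"
  shows "\<exists>n M. n > 0 \<and> (\<forall>i<n. u * u ^ i = (\<Sum>j<n. fps_of_poly (M i j) * u ^ j)) \<and>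
    (\<forall>i<n. \<forall>j<n. M i j \<noteq> 0 \<longrightarrow> int (degree (M i j)) \<le> int q + int (q * i) - int (q * j))"
proof -
  obtain P where P: "lead_coeff P = 1" "weight_le q (int (q * degree P)) P" "bipoly_eval P u = 0"
    using assms unfolding integral_le_def by auto
  let ?n = "degree P"
  have n: "?n > 0"
  proof (rule ccontr)
    assume "\<not> ?n > 0"
    then obtain c where "P = [:c:]" by (metis degree_eq_zeroE neq0_conv)
    with P show False by auto
  qed
  define M where "M i j = (if Suc i < ?n then (if j = Suc i then 1 else 0) else - coeff P j)" for i j
  show ?thesis
  proof (intro exI[of _ ?n] exI[of _ M] conjI allI impI)
    fix i assume i: "i < ?n"
    show "u * u ^ i = (\<Sum>j<?n. fps_of_poly (M i j) * u ^ j)"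
    proof (cases "Suc i < ?n")
      case True
      have "(\<Sum>j<?n. fps_of_poly (M i j) * u ^ j) = (\<Sum>j<?n. if j = Suc i then u ^ j else 0)"
        by (rule sum.cong) (use True in \<open>auto simp: M_def\<close>)
      with True show ?thesis by simp
    next
      case False
      with i have Si: "Suc i = ?n" by simp
      have "0 = (\<Sum>j\<le>?n. fps_of_poly (coeff P j) * u ^ j)" using bipoly_eval_altdef[of P ?n u] P(3) by simp
      also have "\<dots> = (\<Sum>j<?n. fps_of_poly (coeff P j) * u ^ j) + u ^ ?n"
        using P(1) by (simp add: lessThan_Suc_atMost[symmetric])
      finally have "u ^ ?n = - (\<Sum>j<?n. fps_of_poly (coeff P j) * u ^ j)"
        by (simp add: eq_neg_iff_add_eq_0 add.commute)
      with False show ?thesis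
        using Si by (simp add: M_def fps_of_poly_uminus sum_negf power_Suc[symmetric] del: power_Suc)
    qed
  next
    fix i j assume ij: "i < ?n" "j < ?n" and nz: "M i j \<noteq> 0"
    show "int (degree (M i j)) \<le> int q + int (q * i) - int (q * j)"
    proof (cases "Suc i < ?n")
      case True
      with nz show ?thesis by (auto simp: M_def algebra_simps split: if_splits)
    next
      case False
      with ij have "?n = Suc i" by simp
      with P(2) nz False show ?thesis
        unfolding M_def weight_le_def by (auto simp: algebra_simps)
    qed
  qed (fact n)
qed

text \<open>The products of powers of \<open>u\<close> and \<open>u'\<close> form a family on which both series act, so that sums and products
  of integral series are integral.\<close>

lemma integral_le_common_family:
  assumes "u \<in> integral_le q" "u' \<in> integral_le q'"
  obtains I :: "(nat \<times> nat) set" and v w where "finite I" "\<exists>i\<in>I. v i \<noteq> 0"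
    "acts_le I v w (int q) u" "acts_le I v w (int q') u'"
proof -
  obtain n M where n: "n > 0" "\<And>i. i < n \<Longrightarrow> u * u ^ i = (\<Sum>j<n. fps_of_poly (M i j) * u ^ j)"
    "\<And>i j. i < n \<Longrightarrow> j < n \<Longrightarrow> M i j \<noteq> 0 \<Longrightarrow> int (degree (M i j)) \<le> int q + int (q * i) - int (q * j)"
    using integral_le_powers_act[OF assms(1)] by blast
  obtain n' M' where n': "n' > 0" "\<And>i. i < n' \<Longrightarrow> u' * u' ^ i = (\<Sum>j<n'. fps_of_poly (M' i j) * u' ^ j)"
    "\<And>i j. i < n' \<Longrightarrow> j < n' \<Longrightarrow> M' i j \<noteq> 0 \<Longrightarrow> int (degree (M' i j)) \<le> int q' + int (q' * i) - int (q' * j)"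
    using integral_le_powers_act[OF assms(2)] by blast
  let ?I = "{..<n} \<times> {..<n'}"
  define v where "v = (\<lambda>(i, j). u ^ i * u' ^ j)"
  define w where "w = (\<lambda>(i, j). int (q * i) + int (q' * j))"
  have a1: "acts_le ?I v w (int q) u"
    unfolding acts_le_def
  proof (intro exI[of _ "\<lambda>(i, j) (l, k). if k = j then M i l else 0"] conjI ballI impI)
    fix x assume "x \<in> ?I"
    then obtain i j where x: "x = (i, j)" "i < n" "j < n'" by auto
    have "(\<Sum>y\<in>?I. fps_of_poly ((\<lambda>(i, j) (l, k). if k = j then M i l else 0) x y) * v y)
      = (\<Sum>l<n. \<Sum>k<n'. if k = j then fps_of_poly (M i l) * (u ^ l * u' ^ k) else 0)"
      unfolding sum.cartesian_product x(1) by (rule sum.cong) (auto simp: v_def)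
    also have "\<dots> = (\<Sum>l<n. fps_of_poly (M i l) * u ^ l) * u' ^ j"
      using x by (simp add: sum_distrib_left sum_distrib_right mult_ac)
    also have "\<dots> = u * v x" using n(2)[of i] x by (simp add: v_def mult_ac)
    finally show "u * v x = (\<Sum>y\<in>?I. fps_of_poly ((\<lambda>(i, j) (l, k). if k = j then M i l else 0) x y) * v y)" by simp
  next
    fix x y assume "x \<in> ?I" "y \<in> ?I" "(\<lambda>(i, j) (l, k). if k = j then M i l else 0) x y \<noteq> 0"
    then show "int (degree ((\<lambda>(i, j) (l, k). if k = j then M i l else 0) x y)) \<le> int q + w x - w y"
      using n(3)[of "fst x" "fst y"] by (cases x; cases y) (simp add: w_def split: if_splits)
  qed
  have a2: "acts_le ?I v w (int q') u'"
    unfolding acts_le_def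
  proof (intro exI[of _ "\<lambda>(i, j) (l, k). if l = i then M' j k else 0"] conjI ballI impI)
    fix x assume "x \<in> ?I"
    then obtain i j where x: "x = (i, j)" "i < n" "j < n'" by auto
    have "(\<Sum>y\<in>?I. fps_of_poly ((\<lambda>(i, j) (l, k). if l = i then M' j k else 0) x y) * v y)
      = (\<Sum>l<n. \<Sum>k<n'. if l = i then fps_of_poly (M' j k) * (u ^ l * u' ^ k) else 0)"
      unfolding sum.cartesian_product x(1) by (rule sum.cong) (auto simp: v_def)
    also have "\<dots> = (\<Sum>k<n'. \<Sum>l<n. if l = i then fps_of_poly (M' j k) * (u ^ l * u' ^ k) else 0)"
      by (rule sum.swap)
    also have "\<dots> = (\<Sum>k<n'. fps_of_poly (M' j k) * u' ^ k) * u ^ i"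
      using x by (simp add: sum_distrib_left sum_distrib_right mult_ac)
    also have "\<dots> = u' * v x" using n'(2)[of j] x by (simp add: v_def mult_ac)
    finally show "u' * v x = (\<Sum>y\<in>?I. fps_of_poly ((\<lambda>(i, j) (l, k). if l = i then M' j k else 0) x y) * v y)" by simp
  next
    fix x y assume "x \<in> ?I" "y \<in> ?I" "(\<lambda>(i, j) (l, k). if l = i then M' j k else 0) x y \<noteq> 0"
    then show "int (degree ((\<lambda>(i, j) (l, k). if l = i then M' j k else 0) x y)) \<le> int q' + w x - w y"
      using n'(3)[of "snd x" "snd y"] by (cases x; cases y) (simp add: w_def split: if_splits)
  qed
  have nz: "\<exists>i\<in>?I. v i \<noteq> 0"
    using n(1) n'(1) by (intro bexI[of _ "(0, 0)"]) (auto simp: v_def)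
  show thesis by (rule that[OF _ nz a1 a2]) simp
qed

lemma integral_le_add:
  assumes "u \<in> integral_le q" "u' \<in> integral_le q" shows "u + u' \<in> integral_le q"
proof (rule integral_le_common_family[OF assms])
  fix I :: "(nat \<times> nat) set" and v w
  assume I: "finite I" "\<exists>i\<in>I. v i \<noteq> 0" "acts_le I v w (int q) u" "acts_le I v w (int q) u'"
  show ?thesis by (rule acts_le_imp_integral_le[OF I(1,2) acts_le_add[OF I(3,4)]])
qed

lemma integral_le_mult:
  assumes "u \<in> integral_le q" "u' \<in> integral_le q'" shows "u * u' \<in> integral_le (q + q')"
proof (rule integral_le_common_family[OF assms])
  fix I :: "(nat \<times> nat) set" and v w
  assume I: "finite I" "\<exists>i\<in>I. v i \<noteq> 0" "acts_le I v w (int q) u" "acts_le I v w (int q') u'"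
  have "acts_le I v w (int (q + q')) (u * u')" using acts_le_mult[OF I(1,3,4)] by simp
  then show ?thesis by (rule acts_le_imp_integral_le[OF I(1,2)])
qed

lemma integral_le_poly: "degree p \<le> q \<Longrightarrow> fps_of_poly p \<in> integral_le q"
  by (rule acts_le_imp_integral_le[of "{()}" "\<lambda>_. 1" "\<lambda>_. 0"]) (auto intro: acts_le_poly)

lemma integral_le_mono: "u \<in> integral_le q \<Longrightarrow> q \<le> q' \<Longrightarrow> u \<in> integral_le q'"
  using integral_le_mult[of u q 1 "q' - q"] integral_le_poly[of 1 "q' - q"] by simp

lemma integral_le_sum: "(\<And>i. i \<in> I \<Longrightarrow> f i \<in> integral_le q) \<Longrightarrow> (\<Sum>i\<in>I. f i) \<in> integral_le q"
  by (induction I rule: infinite_finite_induct) (use integral_le_poly[of 0 q] in \<open>auto intro: integral_le_add\<close>)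

section \<open>Minimal equations and the order of vanishing\<close>

lemma weight_le_nat_iff:
  "weight_le q (int w) P \<longleftrightarrow> (\<forall>i. coeff P i \<noteq> 0 \<longrightarrow> degree (coeff P i) + q * i \<le> w)"
  unfolding weight_le_def by (metis of_nat_add of_nat_le_iff)

text \<open>The dominant term for the weight, at the largest possible index.\<close>

lemma weight_le_leading:
  fixes R :: "complex poly poly"
  assumes "R \<noteq> 0"
  obtains i w where "coeff R i \<noteq> 0" "degree (coeff R i) + q * i = w" "weight_le q (int w) R"
    "\<And>l. i < l \<Longrightarrow> coeff R l \<noteq> 0 \<Longrightarrow> degree (coeff R l) + q * l < w"
proof -
  let ?I = "{l. coeff R l \<noteq> 0}"
  let ?wt = "\<lambda>l. degree (coeff R l) + q * l"
  have fin: "finite ?I" by (rule finite_subset[of _ "{..degree R}"]) (auto intro: le_degree)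
  have ne: "?I \<noteq> {}" using assms by (auto simp: poly_eq_iff)
  define w where "w = Max (?wt ` ?I)"
  have w: "?wt l \<le> w" if "l \<in> ?I" for l unfolding w_def using fin that by auto
  let ?J = "{l\<in>?I. ?wt l = w}"
  have "w \<in> ?wt ` ?I" unfolding w_def using fin ne by (intro Max_in) auto
  then have J: "finite ?J" "?J \<noteq> {}" using fin by auto
  define i where "i = Max ?J"
  have i: "i \<in> ?J" unfolding i_def using J by (rule Max_in)
  have max: "l \<le> i" if "l \<in> ?J" for l unfolding i_def using J(1) that by (rule Max_ge)
  show thesis
  proof (rule that[of i w])
    show "weight_le q (int w) R" unfolding weight_le_nat_iff using w by simp
    fix l assume l: "i < l" "coeff R l \<noteq> 0"
    then have "?wt l \<noteq> w" using max[of l] by auto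
    with w[of l] l show "?wt l < w" by simp
  qed (use i in auto)
qed

text \<open>The weight of a product is the sum of the weights, since the product of the two dominant terms cannot be
  cancelled. A factor of a monic polynomial that attains the minimal weight therefore attains it as well.\<close>

lemma weight_le_factor:
  assumes R: "lead_coeff R = 1" and S: "lead_coeff S = 1"
    and wt: "weight_le q (int (q * degree (R * S))) (R * S)"
  shows "weight_le q (int (q * degree R)) R"
proof -
  have nz: "R \<noteq> 0" "S \<noteq> 0" using R S by auto
  obtain i w where i: "coeff R i \<noteq> 0" "degree (coeff R i) + q * i = w" "weight_le q (int w) R"
    "\<And>l. i < l \<Longrightarrow> coeff R l \<noteq> 0 \<Longrightarrow> degree (coeff R l) + q * l < w"
    using weight_le_leading[OF nz(1)] by metis
  obtain j v where j: "coeff S j \<noteq> 0" "degree (coeff S j) + q * j = v" "weight_le q (int v) S"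
    "\<And>l. j < l \<Longrightarrow> coeff S l \<noteq> 0 \<Longrightarrow> degree (coeff S l) + q * l < v"
    using weight_le_leading[OF nz(2)] by metis
  have Rw: "degree (coeff R l) + q * l \<le> w" if "coeff R l \<noteq> 0" for l
    using i(3) that unfolding weight_le_nat_iff by blast
  have Sv: "degree (coeff S l) + q * l \<le> v" if "coeff S l \<noteq> 0" for l
    using j(3) that unfolding weight_le_nat_iff by blast
  define e where "e = degree (coeff R i) + degree (coeff S j)"
  have other: "coeff (coeff R l * coeff S (i + j - l)) e = 0" if l: "l \<le> i + j" "l \<noteq> i" for l
  proof (cases "coeff R l = 0 \<or> coeff S (i + j - l) = 0")
    case False
    have "degree (coeff R l) + q * l + (degree (coeff S (i + j - l)) + q * (i + j - l)) < w + v"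
    proof (cases "i < l")
      case True
      with False i(4)[of l] Sv[of "i + j - l"] show ?thesis by linarith
    next
      case F: False
      with l have "j < i + j - l" by linarith
      with False j(4)[of "i + j - l"] Rw[of l] show ?thesis by linarith
    qed
    moreover have "q * l + q * (i + j - l) = q * i + q * j"
      using l by (metis add_mult_distrib2 le_add_diff_inverse)
    ultimately have "degree (coeff R l) + degree (coeff S (i + j - l)) < e"
      using i(2) j(2) unfolding e_def by linarith
    then show ?thesis by (intro coeff_eq_0 le_less_trans[OF degree_mult_le])
  qed auto
  have "coeff (coeff (R * S) (i + j)) e = (\<Sum>l\<le>i + j. coeff (coeff R l * coeff S (i + j - l)) e)"
    by (simp add: coeff_mult coeff_sum)
  also have "\<dots> = coeff (coeff R i * coeff S (i + j - i)) e"
    by (rule sum.remove[THEN trans, of _ i]) (use other in auto)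
  also have "\<dots> = lead_coeff (coeff R i) * lead_coeff (coeff S j)"
    unfolding e_def by (simp add: coeff_mult_degree_sum)
  finally have ne: "coeff (coeff (R * S) (i + j)) e \<noteq> 0" using i(1) j(1) by simp
  then have "e \<le> degree (coeff (R * S) (i + j))" "coeff (R * S) (i + j) \<noteq> 0"
    using le_degree by (blast, auto)
  with wt have "e + q * (i + j) \<le> q * degree (R * S)"
    unfolding weight_le_nat_iff by (meson add_le_mono1 order_trans)
  then have "w + v \<le> q * degree R + q * degree S"
    using i(2) j(2) nz by (simp add: e_def degree_mult_eq algebra_simps)
  moreover have "q * degree S \<le> v" using Sv[of "degree S"] S by simp
  ultimately have "w \<le> q * degree R" by linarith
  with i(3) show ?thesis unfolding weight_le_def by fastforce
qed

text \<open>Gauss's lemma: a primitive annihilator of least degree divides, over \<open>\<complex>[z]\<close>, the monic equation of an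
  integral \<open>u\<close>, so it is itself monic up to a constant. This makes the degree of the integral equation as
  small as that of any algebraic equation.\<close>

lemma bipoly_eval_monic_min:
  assumes u: "u \<in> integral_le q" and R: "R \<noteq> 0" "bipoly_eval R u = 0" "degree R \<le> m"
  shows "\<exists>P. lead_coeff P = 1 \<and> degree P \<le> m \<and> weight_le q (int (q * degree P)) P \<and> bipoly_eval P u = 0 \<and>
    (u \<noteq> 0 \<longrightarrow> coeff P 0 \<noteq> 0)"
proof -
  let ?ann = "\<lambda>n. \<exists>R. R \<noteq> 0 \<and> degree R = n \<and> bipoly_eval R u = 0"
  define n where "n = (LEAST n. ?ann n)"
  have "?ann n" unfolding n_def by (rule LeastI[of ?ann "degree R"]) (use R in auto)
  then obtain R0 where R0: "R0 \<noteq> 0" "degree R0 = n" "bipoly_eval R0 u = 0" by auto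
  have least: "n \<le> degree S" if "S \<noteq> 0" "bipoly_eval S u = 0" for S
    unfolding n_def by (rule Least_le) (use that in auto)
  have nm: "n \<le> m" using least[OF R(1,2)] R(3) by simp
  define R1 where "R1 = primitive_part R0"
  have R1: "R1 \<noteq> 0" "degree R1 = n" "content R1 = 1" using R0 by (auto simp: R1_def)
  have "bipoly_eval (Polynomial.smult (content R0) R1) u = 0" using R0(3) by (simp add: R1_def)
  then have ev1: "bipoly_eval R1 u = 0" using R0(1) by simp
  obtain P where P: "lead_coeff P = 1" "weight_le q (int (q * degree P)) P" "bipoly_eval P u = 0"
    using u unfolding integral_le_def by auto
  obtain a Q where a: "a \<noteq> 0" "Polynomial.smult a P = R1 * Q + pseudo_mod P R1"
    using pseudo_mod(1)[OF R1(1), of P] by auto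
  have "bipoly_eval (pseudo_mod P R1) u = 0"
    using arg_cong[OF a(2), of "\<lambda>P. bipoly_eval P u"] P(3) ev1 by simp
  with pseudo_mod(2)[OF R1(1), of P] least R1(2) have "pseudo_mod P R1 = 0" by force
  with a have aP: "Polynomial.smult a P = R1 * Q" by simp
  have "content P dvd 1" using content_dvd_coeff[of P "degree P"] P(1) by simp
  then have "content P = 1" using is_unit_content_iff by blast
  then have "normalize a = content Q"
    using arg_cong[OF aP, of content] R1(3) by (simp add: content_mult)
  then have "a dvd content Q" by (metis dvd_normalize_iff dvd_refl)
  then have "[:a:] dvd Q" by (simp add: const_poly_dvd_iff_dvd_content)
  then obtain Q' where "Q = [:a:] * Q'" by (rule dvdE)
  then have Q': "Q = Polynomial.smult a Q'" by simp
  with aP have "Polynomial.smult a P = Polynomial.smult a (R1 * Q')" by simp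
  with a(1) have PQ: "P = R1 * Q'" by (metis smult_cancel)
  with P(1) have lc: "lead_coeff R1 * lead_coeff Q' = 1" by (simp add: lead_coeff_mult)
  define R2 where "R2 = Polynomial.smult (lead_coeff Q') R1"
  define S where "S = Polynomial.smult (lead_coeff R1) Q'"
  have R2: "lead_coeff R2 = 1" "lead_coeff S = 1" "degree R2 = n" "bipoly_eval R2 u = 0"
    using lc ev1 R1(2) by (auto simp: R2_def S_def mult.commute)
  have "R2 * S = P" using lc PQ by (simp add: R2_def S_def mult.commute)
  then have "weight_le q (int (q * degree R2)) R2" using weight_le_factor[OF R2(1,2)] P(2) by simp
  moreover have "coeff R2 0 \<noteq> 0" if "u \<noteq> 0"
  proof
    assume c0: "coeff R2 0 = 0"
    obtain c T where T: "R2 = pCons c T" by (cases R2)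
    with c0 have R2T: "R2 = pCons 0 T" by simp
    then have "T \<noteq> 0" using R2(1) by auto
    moreover have "bipoly_eval T u = 0" using R2(4) R2T that by simp
    ultimately show False using least[of T] R2(3) R2T by simp
  qed
  ultimately show ?thesis using R2 nm by blast
qed

text \<open>The series \<open>u\<close> divides the constant term of its equation, whose degree is bounded by the weight.\<close>

lemma subdegree_le_of_monic:
  assumes P: "weight_le q (int w) P" "bipoly_eval P u = 0" "coeff P 0 \<noteq> 0"
  shows "subdegree u \<le> w"
proof -
  obtain c T where T: "P = pCons c T" by (cases P)
  have c: "c \<noteq> 0" "degree c \<le> w"
    using P(1,3) unfolding T weight_le_def by (auto dest: spec[of _ 0])
  have eq: "fps_of_poly c = - (u * bipoly_eval T u)" using P(2) T by (simp add: eq_neg_iff_add_eq_0)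
  then have nz: "u * bipoly_eval T u \<noteq> 0" using c(1) by auto
  then have "subdegree u \<le> subdegree (u * bipoly_eval T u)" by (simp add: subdegree_mult)
  also have "\<dots> = subdegree (fps_of_poly c)" unfolding eq by simp
  also have "\<dots> \<le> degree c"
    by (rule subdegree_leI) (use c(1) in simp)
  finally show ?thesis using c(2) by simp
qed

section \<open>The substitution of a power of z and the Euler derivation\<close>

definition stretch :: "nat \<Rightarrow> complex fps \<Rightarrow> complex fps" where
  "stretch N f = fps_compose f (fps_X ^ N)"

definition poly_stretch :: "nat \<Rightarrow> complex poly \<Rightarrow> complex poly" where
  "poly_stretch N p = pcompose p (monom 1 N)"

lemma stretch_simps [simp]:
  assumes "N > 0"
  shows "stretch N (f + g) = stretch N f + stretch N g" "stretch N (f - g) = stretch N f - stretch N g" "stretch N (- f) = - stretch N f"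
    "stretch N (f * g) = stretch N f * stretch N g" "stretch N 0 = 0" "stretch N 1 = 1"
    "stretch N (fps_of_poly p) = fps_of_poly (poly_stretch N p)" "stretch N (f ^ n) = stretch N f ^ n"
  using assms
  by (simp_all add: stretch_def fps_compose_add_distrib fps_compose_sub_distrib fps_compose_uminus
    fps_compose_mult_distrib fps_compose_power poly_stretch_def fps_of_poly_pcompose fps_of_poly_monom')

lemma stretch_sum [simp]: "N > 0 \<Longrightarrow> stretch N (sum f A) = (\<Sum>x\<in>A. stretch N (f x))"
  by (induction A rule: infinite_finite_induct) auto

lemma stretch_prod [simp]: "N > 0 \<Longrightarrow> stretch N (prod f A) = (\<Prod>x\<in>A. stretch N (f x))"
  by (induction A rule: infinite_finite_induct) auto

lemma stretch_nth: "N > 0 \<Longrightarrow> stretch N f $ n = (if N dvd n then f $ (n div N) else 0)"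
proof -
  assume N: "N > 0"
  have "stretch N f $ n = (\<Sum>i = 0..n. f $ i * (if n = N * i then 1 else 0))"
    by (simp add: stretch_def fps_compose_nth flip: power_mult)
  also have "\<dots> = (\<Sum>i\<in>(if N dvd n then {n div N} else {}). f $ i)"
    by (rule sum.mono_neutral_cong_right) (use N in \<open>auto split: if_splits\<close>)
  finally show ?thesis by simp
qed

lemma stretch_stretch:
  assumes "N > 0" "M > 0" shows "stretch N (stretch M f) = stretch (N * M) f"
proof (rule fps_ext)
  fix n
  show "stretch N (stretch M f) $ n = stretch (N * M) f $ n"
  proof (cases "N dvd n")
    case True
    then obtain l where "n = N * l" by (rule dvdE)
    with assms show ?thesis by (simp add: stretch_nth)
  next
    case False
    then have "\<not> N * M dvd n" using dvd_mult_left by blast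
    with False assms show ?thesis by (simp add: stretch_nth)
  qed
qed

lemma stretch_eq_0_iff [simp]: "N > 0 \<Longrightarrow> stretch N f = 0 \<longleftrightarrow> f = 0"
proof
  assume N: "N > 0" and 0: "stretch N f = 0"
  show "f = 0"
  proof (rule fps_ext)
    fix n show "f $ n = 0 $ n" using stretch_nth[OF N, of f "N * n"] N 0 by simp
  qed
qed simp

lemma degree_poly_stretch [simp]: "degree (poly_stretch N p) = N * degree p"
  by (simp add: poly_stretch_def degree_monom_eq)

lemma poly_stretch_eq_0_iff [simp]: "N > 0 \<Longrightarrow> poly_stretch N p = 0 \<longleftrightarrow> p = 0"
  by (metis fps_of_poly_eq_iff fps_of_poly_0 stretch_eq_0_iff stretch_simps(7))

lemma poly_stretch_0 [simp]: "poly_stretch N 0 = 0" and poly_stretch_1 [simp]: "poly_stretch N 1 = 1"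
  by (auto simp: poly_stretch_def pcompose_1)

lemma stretch_bipoly_eval: "N > 0 \<Longrightarrow> stretch N (bipoly_eval P u) = bipoly_eval (map_poly (poly_stretch N) P) (stretch N u)"
proof -
  assume N: "N > 0"
  have d: "degree (map_poly (poly_stretch N) P) = degree P" using N
    by (cases "P = 0") (auto intro!: degree_map_poly)
  show ?thesis
    using N by (simp add: bipoly_eval_altdef[OF order_refl] d coeff_map_poly)
qed

lemma integral_le_stretch:
  assumes "N > 0" "u \<in> integral_le q" shows "stretch N u \<in> integral_le (N * q)"
proof -
  obtain P where P: "lead_coeff P = 1" "weight_le q (int (q * degree P)) P" "bipoly_eval P u = 0"
    using assms unfolding integral_le_def by auto
  let ?P = "map_poly (poly_stretch N) P"
  have d: "degree ?P = degree P" using assms(1)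
    by (cases "P = 0") (auto intro!: degree_map_poly)
  have "lead_coeff ?P = 1" unfolding d using P(1) by (simp add: coeff_map_poly)
  moreover have "bipoly_eval ?P (stretch N u) = 0" using stretch_bipoly_eval[OF assms(1), of P u] P(3) assms(1) by simp
  moreover have "weight_le (N * q) (int (N * q * degree ?P)) ?P"
    unfolding weight_le_nat_iff d
  proof (intro allI impI)
    fix i assume nz: "coeff ?P i \<noteq> 0"
    have c: "coeff ?P i = poly_stretch N (coeff P i)" by (simp add: coeff_map_poly)
    with nz have "coeff P i \<noteq> 0" using assms(1) by auto
    with P(2) have "degree (coeff P i) + q * i \<le> q * degree P"
      unfolding weight_le_nat_iff by blast
    then have "N * (degree (coeff P i) + q * i) \<le> N * (q * degree P)" by (rule mult_le_mono2)
    then show "degree (coeff ?P i) + N * q * i \<le> N * q * degree P"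
      unfolding c degree_poly_stretch by (simp add: algebra_simps)
  qed
  ultimately show ?thesis unfolding integral_le_def by blast
qed

definition euler :: "complex fps \<Rightarrow> complex fps" where
  "euler f = fps_X * fps_deriv f"

lemma euler_nth [simp]: "euler f $ n = of_nat n * f $ n"
  by (cases n) (auto simp: euler_def)

lemma euler_add [simp]: "euler (f + g) = euler f + euler g"
  and euler_mult [simp]: "euler (f * g) = euler f * g + f * euler g"
  and euler_0 [simp]: "euler 0 = 0" and euler_1 [simp]: "euler 1 = 0"
  by (auto simp: euler_def algebra_simps)

lemma euler_sum [simp]: "euler (sum f A) = (\<Sum>x\<in>A. euler (f x))"
  by (induction A rule: infinite_finite_induct) auto

definition poly_euler :: "complex poly \<Rightarrow> complex poly" where
  "poly_euler p = monom 1 1 * pderiv p"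

lemma euler_poly [simp]: "euler (fps_of_poly p) = fps_of_poly (poly_euler p)"
  by (simp add: euler_def poly_euler_def hom_distribs fps_of_poly_pderiv fps_of_poly_monom')

lemma degree_poly_euler: "degree (poly_euler p) \<le> degree p"
  by (rule degree_le) (auto simp: poly_euler_def coeff_monom_mult coeff_pderiv coeff_eq_0)

lemma euler_stretch: "N > 0 \<Longrightarrow> euler (stretch N f) = of_nat N * stretch N (euler f)"
  by (rule fps_ext) (auto simp: stretch_nth fps_mult_of_nat_nth elim!: dvdE)

section \<open>Sections and descent along the substitution\<close>

definition fps_section :: "nat \<Rightarrow> nat \<Rightarrow> complex fps \<Rightarrow> complex fps" where
  "fps_section N e f = Abs_fps (\<lambda>n. f $ (N * n + e))"

lemma fps_section_sum: "fps_section N e (sum f A) = (\<Sum>x\<in>A. fps_section N e (f x))"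
  by (rule fps_ext) (simp add: fps_section_def fps_sum_nth)

text \<open>The bound \<open>e < N\<close> is needed: otherwise coefficients of \<open>f\<close> below \<open>e\<close> would contribute as well.\<close>

lemma fps_section_mult_stretch:
  assumes "e < N" shows "fps_section N e (f * stretch N g) = fps_section N e f * g"
proof (rule fps_ext)
  fix n
  have N: "N > 0" using assms by simp
  have inj: "inj_on (\<lambda>l. N * l + e) {..n}" using N by (auto simp: inj_on_def)
  have "fps_section N e (f * stretch N g) $ n = (\<Sum>i\<le>N * n + e. f $ i * stretch N g $ (N * n + e - i))"
    by (simp add: fps_section_def fps_mult_nth atLeast0AtMost)
  also have "\<dots> = (\<Sum>i\<in>(\<lambda>l. N * l + e) ` {..n}. f $ i * stretch N g $ (N * n + e - i))"
  proof (rule sum.mono_neutral_right)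
    show "\<forall>i\<in>{..N * n + e} - (\<lambda>l. N * l + e) ` {..n}. f $ i * stretch N g $ (N * n + e - i) = 0"
    proof
      fix i assume i: "i \<in> {..N * n + e} - (\<lambda>l. N * l + e) ` {..n}"
      have "\<not> N dvd (N * n + e - i)"
      proof
        assume "N dvd (N * n + e - i)"
        then obtain j where j: "N * n + e - i = N * j" by (rule dvdE)
        with i have eq: "N * n + e = N * j + i" by auto
        have "j \<le> n"
        proof (rule ccontr)
          assume "\<not> j \<le> n"
          then have "N * Suc n \<le> N * j" by (intro mult_le_mono2) simp
          with eq assms show False by simp
        qed
        then have "N * j + N * (n - j) = N * n" by (metis add_mult_distrib2 le_add_diff_inverse)
        with eq have "i = N * (n - j) + e" by linarith
        with i show False by auto
      qed
      with N show "f $ i * stretch N g $ (N * n + e - i) = 0" by (simp add: stretch_nth)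
    qed
  qed auto
  also have "\<dots> = (\<Sum>l\<le>n. f $ (N * l + e) * g $ (n - l))"
    unfolding sum.reindex[OF inj] o_def
  proof (rule sum.cong[OF refl])
    fix l assume "l \<in> {..n}"
    then have "N * n + e - (N * l + e) = N * (n - l)" by (simp add: diff_mult_distrib2)
    then show "f $ (N * l + e) * stretch N g $ (N * n + e - (N * l + e)) = f $ (N * l + e) * g $ (n - l)"
      using N by (simp add: stretch_nth)
  qed
  also have "\<dots> = (fps_section N e f * g) $ n" by (simp add: fps_section_def fps_mult_nth atLeast0AtMost)
  finally show "fps_section N e (f * stretch N g) $ n = (fps_section N e f * g) $ n" .
qed

definition poly_section :: "nat \<Rightarrow> nat \<Rightarrow> complex poly \<Rightarrow> complex poly" where
  "poly_section N e p = (\<Sum>n\<le>degree p. monom (coeff p (N * n + e)) n)"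

lemma coeff_poly_section: "N > 0 \<Longrightarrow> coeff (poly_section N e p) n = coeff p (N * n + e)"
proof -
  assume N: "N > 0"
  have "n \<le> N * n + e" using N by (metis One_nat_def Suc_leI le_add1 mult_1 mult_le_mono1 order_trans)
  then have "coeff p (N * n + e) = 0" if "n > degree p" using that by (intro coeff_eq_0) simp
  then show ?thesis by (auto simp: poly_section_def coeff_sum coeff_monom not_le)
qed

lemma fps_section_poly: "N > 0 \<Longrightarrow> fps_section N e (fps_of_poly p) = fps_of_poly (poly_section N e p)"
  by (rule fps_ext) (simp add: fps_section_def coeff_poly_section)

lemma degree_poly_section: "N > 0 \<Longrightarrow> poly_section N e p \<noteq> 0 \<Longrightarrow> N * degree (poly_section N e p) + e \<le> degree p"
  by (rule le_degree) (simp flip: coeff_poly_section)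

lemma coeff_power_lowest:
  fixes D :: "complex poly"
  assumes "D \<noteq> 0"
  obtains j where "j \<le> degree D" "\<And>r. coeff (D ^ r) (r * j) \<noteq> 0"
proof -
  let ?j = "Polynomial.order 0 D"
  obtain D1 where D1: "D = [:0, 1:] ^ ?j * D1" "\<not> [:0, 1:] dvd D1"
    using order_decomp[OF assms, of 0] by auto
  have "coeff D1 0 \<noteq> 0" using D1(2) by (simp add: dvd_iff_poly_eq_0 poly_0_coeff_0 flip: poly_eq_0_iff_dvd)
  moreover have "coeff (D ^ r) (r * ?j) = coeff D1 0 ^ r" for r
  proof -
    have "[:0, 1:] = (monom 1 1 :: complex poly)" by (simp add: monom_altdef)
    then have "D ^ r = monom 1 (r * ?j) * D1 ^ r"
      by (subst D1(1)) (simp add: power_mult_distrib monom_power mult.commute flip: power_mult)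
    then show ?thesis by (simp add: coeff_monom_mult coeff_0_power)
  qed
  ultimately show thesis using order_degree[OF assms] by (intro that[of ?j]) auto
qed

text \<open>Take the equation of \<open>D h(z\<^sup>N)\<close>, of degree \<open>r\<close>, and keep only the exponents of \<open>z\<close> congruent to \<open>r j\<close>
  modulo \<open>N\<close>, where \<open>j\<close> is the order of \<open>D\<close> at \<open>0\<close>. This is an equation for \<open>h\<close>. Its leading coefficient is the
  section of \<open>D\<^sup>r\<close>, which is a nonzero constant because \<open>degree (D\<^sup>r) < N\<close>. All degrees are divided by \<open>N\<close>,
  so the excess \<open>c\<close> is rounded away.\<close>

lemma integral_le_descent:
  assumes D: "D \<noteq> 0" "degree D \<le> e" and N: "m * (c + e) < N"
    and P: "lead_coeff P = 1" "degree P \<le> m" "weight_le (N * q + c) (int ((N * q + c) * degree P)) P"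
      "bipoly_eval P (fps_of_poly D * stretch N h) = 0"
  shows "h \<in> integral_le q"
proof -
  have N0: "N > 0" using N by simp
  let ?r = "degree P"
  obtain j where j: "j \<le> degree D" "\<And>r. coeff (D ^ r) (r * j) \<noteq> 0"
    using coeff_power_lowest[OF D(1)] by metis
  define E where "E = ?r * j"
  have re: "?r * e \<le> m * e" "?r * (c + e) \<le> m * (c + e)" using P(2) by (auto intro: mult_le_mono)
  have "E \<le> ?r * e" unfolding E_def using j(1) D(2) by (intro mult_le_mono) auto
  with re(1) have "E \<le> m * e" by linarith
  also have "\<dots> \<le> m * (c + e)" by simp
  finally have EN: "E < N" using N by (rule le_less_trans)
  define a where "a i = poly_section N E (coeff P i * D ^ i)" for i
  have "0 = fps_section N E (\<Sum>i\<le>?r. fps_of_poly (coeff P i * D ^ i) * stretch N (h ^ i))"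
    using P(4) N0 by (simp add: bipoly_eval_altdef[OF order_refl] hom_distribs power_mult_distrib mult_ac fps_section_def)
      (simp add: fps_eq_iff)
  also have "\<dots> = (\<Sum>i\<le>?r. fps_of_poly (a i) * h ^ i)"
    by (simp add: fps_section_sum fps_section_mult_stretch[OF EN] fps_section_poly[OF N0] a_def)
  finally have rel: "(\<Sum>i\<le>?r. fps_of_poly (a i) * h ^ i) = 0" by simp
  have ar: "a ?r = poly_section N E (D ^ ?r)" using P(1) by (simp add: a_def)
  define g where "g = coeff (D ^ ?r) (?r * j)"
  have g: "g \<noteq> 0" using j(2) by (simp add: g_def)
  have c0: "coeff (a ?r) 0 = g" unfolding ar by (simp add: coeff_poly_section[OF N0] g_def E_def)
  then have "a ?r \<noteq> 0" using g by auto
  with degree_poly_section[OF N0, of E "D ^ ?r"] have "N * degree (a ?r) + E \<le> degree (D ^ ?r)" by (simp add: ar)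
  also have "\<dots> \<le> ?r * e" using D by (simp add: degree_power_eq mult.commute)
  also have "\<dots> \<le> m * e" by (rule re(1))
  also have "\<dots> \<le> m * (c + e)" by simp
  also have "\<dots> < N" by (rule N)
  finally have "N * degree (a ?r) < N * 1" by linarith
  then have "degree (a ?r) = 0" using N0 by simp
  then have ag: "a ?r = [:g:]" using c0 by (metis degree_eq_zeroE coeff_pCons_0)
  define R where "R = (\<Sum>i\<le>?r. monom ([:inverse g:] * a i) i)"
  have cR: "coeff R i = (if i \<le> ?r then [:inverse g:] * a i else 0)" for i
    by (auto simp: R_def coeff_sum)
  have R1: "coeff R ?r = 1" using g ag by (simp add: cR one_pCons)
  moreover have "degree R = ?r"
  proof (rule antisym)
    show "degree R \<le> ?r" by (rule degree_le) (simp add: cR)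
    show "?r \<le> degree R" by (rule le_degree) (simp add: R1)
  qed
  ultimately have lc: "degree R = ?r" "lead_coeff R = 1" by auto
  have "bipoly_eval R h = (\<Sum>i\<le>?r. fps_of_poly [:inverse g:] * (fps_of_poly (a i) * h ^ i))"
    unfolding bipoly_eval_altdef[OF order_refl] lc(1) by (rule sum.cong) (auto simp: cR fps_of_poly_mult mult_ac)
  also have "\<dots> = 0" by (simp only: rel mult_zero_right flip: sum_distrib_left)
  finally have "bipoly_eval R h = 0" .
  moreover have "weight_le q (int (q * degree R)) R"
    unfolding weight_le_nat_iff lc(1)
  proof (intro allI impI)
    fix i assume "coeff R i \<noteq> 0"
    then have i: "i \<le> ?r" "a i \<noteq> 0" by (auto simp: cR split: if_splits)
    then have Pi: "coeff P i \<noteq> 0" by (auto simp: a_def poly_section_def)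
    have "degree (coeff P i) + (N * q + c) * i \<le> (N * q + c) * ?r"
      using P(3) Pi unfolding weight_le_nat_iff by blast
    then have dP: "degree (coeff P i) \<le> (N * q + c) * (?r - i)" by (simp add: diff_mult_distrib2)
    have "N * degree (a i) \<le> degree (coeff P i * D ^ i)"
      using degree_poly_section[OF N0, of E "coeff P i * D ^ i"] i(2) by (simp add: a_def)
    also have "\<dots> \<le> (N * q + c) * (?r - i) + i * e"
      using dP D Pi by (simp add: degree_mult_eq degree_power_eq add_mono mult.commute)
    also have "\<dots> \<le> N * (q * (?r - i)) + ?r * (c + e)"
    proof -
      have "c * (?r - i) \<le> c * ?r" by (rule mult_le_mono2) simp
      moreover have "i * e \<le> ?r * e" using i(1) by (rule mult_le_mono1)
      moreover have "(N * q + c) * (?r - i) = N * (q * (?r - i)) + c * (?r - i)"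
        by (simp add: add_mult_distrib)
      ultimately show ?thesis by (simp only: add_mult_distrib2 mult.commute[of ?r c])
    qed
    also have "\<dots> < N * (q * (?r - i)) + N" using re(2) N by linarith
    also have "\<dots> = N * Suc (q * (?r - i))" by simp
    finally have "degree (a i) < Suc (q * (?r - i))" using N0 by (simp only: mult_less_cancel1)
    moreover have "q * (?r - i) + q * i = q * ?r"
      using i(1) by (simp flip: add_mult_distrib2)
    ultimately show "degree (coeff R i) + q * i \<le> q * ?r"
      using i g by (simp add: cR degree_mult_eq)
  qed
  ultimately show ?thesis unfolding integral_le_def using lc by blast
qed

section \<open>Rings of power series of finite rank\<close>

text \<open>Linear dependence over \<open>\<complex>(z)\<close>, with denominators cleared.\<close>

definition poly_dependent :: "nat \<Rightarrow> (nat \<Rightarrow> complex fps) \<Rightarrow> bool" where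
  "poly_dependent n x \<longleftrightarrow> (\<exists>p. (\<exists>i<n. p i \<noteq> 0) \<and> (\<Sum>i<n. fps_of_poly (p i) * x i) = 0)"

text \<open>Dependence of any \<open>s + 1\<close> elements expresses that \<open>L\<close> generates a space of dimension at most \<open>s\<close> over
  \<open>\<complex>(z)\<close>.\<close>

locale finite_rank_ring =
  fixes L :: "complex fps set"
  assumes poly_mem: "fps_of_poly p \<in> L"
    and add_mem: "f \<in> L \<Longrightarrow> g \<in> L \<Longrightarrow> f + g \<in> L"
    and mult_mem: "f \<in> L \<Longrightarrow> g \<in> L \<Longrightarrow> f * g \<in> L"
    and rank_bound: "\<exists>s. \<forall>x. (\<forall>i\<le>s. x i \<in> L) \<longrightarrow> poly_dependent (Suc s) x"
begin

lemma zero_mem: "0 \<in> L" and one_mem: "1 \<in> L"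
  using poly_mem[of 0] poly_mem[of 1] by auto

lemma sum_mem: "(\<And>i. i \<in> I \<Longrightarrow> f i \<in> L) \<Longrightarrow> (\<Sum>i\<in>I. f i) \<in> L"
  by (induction I rule: infinite_finite_induct) (auto intro: add_mem zero_mem)

lemma power_mem: "f \<in> L \<Longrightarrow> f ^ n \<in> L"
  by (induction n) (auto intro: mult_mem one_mem)

lemma bipoly_eval_mem: "u \<in> L \<Longrightarrow> bipoly_eval P u \<in> L"
  unfolding bipoly_eval_altdef[OF order_refl] by (intro sum_mem mult_mem poly_mem power_mem)

definition rk :: nat where
  "rk = (LEAST s. \<forall>x. (\<forall>i\<le>s. x i \<in> L) \<longrightarrow> poly_dependent (Suc s) x)"

lemma poly_dependent_rk: "(\<And>i. i \<le> rk \<Longrightarrow> x i \<in> L) \<Longrightarrow> poly_dependent (Suc rk) x"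
  using LeastI_ex[OF rank_bound] unfolding rk_def[symmetric] by blast

lemma rk_pos: "rk > 0"
proof (rule ccontr)
  assume "\<not> rk > 0"
  with poly_dependent_rk[of "\<lambda>_. 1"] show False by (auto simp: poly_dependent_def one_mem)
qed

lemma rk_independent: obtains b where "\<And>i. i < rk \<Longrightarrow> b i \<in> L" "\<not> poly_dependent rk b"
proof -
  obtain s where s: "rk = Suc s" using rk_pos by (cases rk) auto
  have "\<not> (\<forall>x. (\<forall>i\<le>s. x i \<in> L) \<longrightarrow> poly_dependent (Suc s) x)"
    by (rule not_less_Least) (use s in \<open>simp add: rk_def\<close>)
  then show thesis using that s by (metis less_Suc_eq_le)
qed

text \<open>The powers \<open>1, u, \<dots>, u\<^bsup>rk\<^esup>\<close> are dependent.\<close>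

lemma annihilator:
  assumes "u \<in> L" obtains R where "R \<noteq> 0" "degree R \<le> rk" "bipoly_eval R u = 0"
proof -
  obtain p where p: "\<exists>i<Suc rk. p i \<noteq> 0" "(\<Sum>i<Suc rk. fps_of_poly (p i) * u ^ i) = 0"
    using poly_dependent_rk[of "\<lambda>i. u ^ i"] power_mem[OF assms] unfolding poly_dependent_def by blast
  define R where "R = (\<Sum>i\<le>rk. monom (p i) i)"
  have c: "coeff R i = (if i \<le> rk then p i else 0)" for i
    by (auto simp: R_def coeff_sum)
  have d: "degree R \<le> rk" by (rule degree_le) (simp add: c)
  have "bipoly_eval R u = (\<Sum>i\<le>rk. fps_of_poly (p i) * u ^ i)"
    unfolding bipoly_eval_altdef[OF d] by (rule sum.cong) (auto simp: c)
  also have "\<dots> = 0" using p(2) by (simp add: lessThan_Suc_atMost)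
  finally have "bipoly_eval R u = 0" .
  moreover have "R \<noteq> 0"
  proof
    assume "R = 0"
    obtain i where "i < Suc rk" "p i \<noteq> 0" using p(1) by blast
    with c[of i] \<open>R = 0\<close> show False by simp
  qed
  ultimately show thesis using d that by blast
qed

text \<open>Multiplying an algebraic \<open>u\<close> by the leading coefficient of its equation makes it integral.\<close>

lemma integral_multiple:
  assumes "u \<in> L" shows "\<exists>D q. D \<noteq> 0 \<and> fps_of_poly D * u \<in> integral_le q"
proof -
  obtain R where R: "R \<noteq> 0" "bipoly_eval R u = 0" using annihilator[OF assms] by metis
  let ?r = "degree R" and ?\<rho> = "lead_coeff R"
  have r: "?r > 0"
  proof (rule ccontr)
    assume "\<not> ?r > 0"
    then obtain c where "R = [:c:]" by (metis degree_eq_zeroE neq0_conv)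
    with R show False by simp
  qed
  define a where "a i = coeff R i * ?\<rho> ^ (?r - 1 - i)" for i
  define P where "P = monom 1 ?r + (\<Sum>i<?r. monom (a i) i)"
  have c: "coeff P i = (if i = ?r then 1 else if i < ?r then a i else 0)" for i
    by (auto simp: P_def coeff_sum)
  have d: "degree P = ?r"
    by (rule antisym[OF degree_le le_degree]) (auto simp: c)
  define q where "q = (\<Sum>i<?r. degree (a i))"
  have dq: "degree (a i) \<le> q" if "i < ?r" for i
    unfolding q_def by (rule member_le_sum) (use that in auto)
  have "weight_le q (int (q * degree P)) P"
    unfolding weight_le_nat_iff d
  proof (intro allI impI)
    fix i assume nz: "coeff P i \<noteq> 0"
    show "degree (coeff P i) + q * i \<le> q * ?r"
    proof (cases "i = ?r")
      case False
      with nz have i: "i < ?r" "coeff P i = a i" by (auto simp: c split: if_splits)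
      then have "degree (coeff P i) + q * i \<le> q * Suc i" using dq by simp
      also have "\<dots> \<le> q * ?r" using i by (intro mult_le_mono2) simp
      finally show ?thesis .
    qed (simp add: c)
  qed
  moreover have "lead_coeff P = 1" by (simp add: d c)
  moreover have "bipoly_eval P (fps_of_poly ?\<rho> * u) = 0"
  proof -
    let ?s = "fps_of_poly ?\<rho>"
    have t: "fps_of_poly (a i) * (?s * u) ^ i = ?s ^ (?r - 1) * (fps_of_poly (coeff R i) * u ^ i)" if "i < ?r" for i
    proof -
      have "?s ^ (?r - 1 - i) * ?s ^ i = ?s ^ (?r - 1)" using that by (simp flip: power_add)
      then show ?thesis by (simp add: a_def hom_distribs power_mult_distrib mult_ac)
    qed
    have st: "(\<Sum>i<?r. fps_of_poly (a i) * (?s * u) ^ i)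
        = ?s ^ (?r - 1) * (\<Sum>i<?r. fps_of_poly (coeff R i) * u ^ i)"
      unfolding sum_distrib_left by (rule sum.cong) (simp_all only: t lessThan_iff)
    have "bipoly_eval P (?s * u) = (?s * u) ^ ?r + (\<Sum>i<?r. fps_of_poly (a i) * (?s * u) ^ i)"
      unfolding bipoly_eval_altdef[OF order_refl] d by (simp add: c lessThan_Suc_atMost[symmetric])
    also have "(?s * u) ^ ?r = ?s ^ (?r - 1) * (?s * u ^ ?r)"
      using r by (simp add: power_mult_distrib power_eq_if[of ?s ?r])
    also have "\<dots> + (\<Sum>i<?r. fps_of_poly (a i) * (?s * u) ^ i) = ?s ^ (?r - 1) * bipoly_eval R u"
      unfolding bipoly_eval_altdef[OF order_refl, of R]
      unfolding st by (simp add: lessThan_Suc_atMost[symmetric] algebra_simps)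
    finally show ?thesis using R(2) by simp
  qed
  ultimately have "fps_of_poly ?\<rho> * u \<in> integral_le q" unfolding integral_le_def by blast
  then show ?thesis using R(1) by (intro exI[of _ ?\<rho>]) auto
qed

lemma common_integral_multiple:
  fixes n :: nat
  assumes "\<And>i. i < n \<Longrightarrow> x i \<in> L"
  shows "\<exists>E q. E \<noteq> 0 \<and> (\<forall>i<n. fps_of_poly E * x i \<in> integral_le q)"
  using assms
proof (induction n)
  case (Suc n)
  obtain E q where E: "E \<noteq> 0" "\<And>i. i < n \<Longrightarrow> fps_of_poly E * x i \<in> integral_le q"
    using Suc.IH Suc.prems by (metis less_SucI)
  obtain D r where D: "D \<noteq> 0" "fps_of_poly D * x n \<in> integral_le r"
    using integral_multiple[OF Suc.prems[of n]] by auto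
  let ?q = "degree E + degree D + q + r"
  show ?case
  proof (intro exI[of _ "D * E"] exI[of _ ?q] conjI allI impI)
    fix i assume i: "i < Suc n"
    show "fps_of_poly (D * E) * x i \<in> integral_le ?q"
    proof (cases "i = n")
      case True
      have "fps_of_poly E * (fps_of_poly D * x n) \<in> integral_le (degree E + r)"
        by (intro integral_le_mult integral_le_poly order_refl D)
      then show ?thesis using True by (auto simp: hom_distribs mult_ac intro: integral_le_mono)
    next
      case False
      have "fps_of_poly D * (fps_of_poly E * x i) \<in> integral_le (degree D + q)"
        by (intro integral_le_mult integral_le_poly order_refl E) (use i False in simp)
      then show ?thesis by (auto simp: hom_distribs mult_ac intro: integral_le_mono)
    qed
  qed (use E D in simp)
qed (auto intro: exI[of _ 1])

lemma integral_independent: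
  obtains b c where "\<And>i. i < rk \<Longrightarrow> b i \<in> L" "\<And>i. i < rk \<Longrightarrow> b i \<in> integral_le c" "\<not> poly_dependent rk b"
proof -
  obtain b where b: "\<And>i. i < rk \<Longrightarrow> b i \<in> L" "\<not> poly_dependent rk b" using rk_independent by metis
  obtain E q where E: "E \<noteq> 0" "\<And>i. i < rk \<Longrightarrow> fps_of_poly E * b i \<in> integral_le q"
    using common_integral_multiple[of rk b] b(1) by metis
  have "\<not> poly_dependent rk (\<lambda>i. fps_of_poly E * b i)"
  proof
    assume "poly_dependent rk (\<lambda>i. fps_of_poly E * b i)"
    then obtain p where p: "\<exists>i<rk. p i \<noteq> 0" "(\<Sum>i<rk. fps_of_poly (p i) * (fps_of_poly E * b i)) = 0"
      unfolding poly_dependent_def by blast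
    then have "(\<Sum>i<rk. fps_of_poly (p i * E) * b i) = 0" by (simp add: hom_distribs mult_ac)
    with p(1) E(1) have "poly_dependent rk b" unfolding poly_dependent_def by (intro exI[of _ "\<lambda>i. p i * E"]) auto
    with b(2) show False ..
  qed
  with E(2) b(1) show thesis by (intro that[of "\<lambda>i. fps_of_poly E * b i" q]) (auto intro: mult_mem poly_mem)
qed

lemma subdegree_bound:
  assumes "u \<in> L" "u \<in> integral_le q" "u \<noteq> 0" shows "subdegree u \<le> q * rk"
proof -
  obtain R where "R \<noteq> 0" "degree R \<le> rk" "bipoly_eval R u = 0" using annihilator[OF assms(1)] by metis
  then obtain P where P: "degree P \<le> rk" "weight_le q (int (q * degree P)) P" "bipoly_eval P u = 0" "coeff P 0 \<noteq> 0"
    using bipoly_eval_monic_min[OF assms(2), of R rk] assms(3) by metis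
  have "subdegree u \<le> q * degree P" by (rule subdegree_le_of_monic[OF P(2-4)])
  with P(1) show ?thesis by (meson mult_le_mono2 order_trans)
qed

text \<open>More than \<open>q rk + 1\<close> series admit a nonzero linear combination that vanishes at \<open>0\<close> to order larger
  than \<open>q rk\<close>; by the bound on the order of vanishing, it is zero.\<close>

lemma linear_dependence:
  assumes T: "finite T" "q * rk + 1 < card T"
    and g: "\<And>t. t \<in> T \<Longrightarrow> g t \<in> L" "\<And>t. t \<in> T \<Longrightarrow> g t \<in> integral_le q"
  shows "\<exists>x. (\<exists>t\<in>T. x t \<noteq> 0) \<and> (\<Sum>t\<in>T. fps_const (x t) * g t) = 0"
proof -
  obtain x where x: "\<exists>t\<in>T. x t \<noteq> 0" "\<forall>j<q * rk + 1. (\<Sum>t\<in>T. x t * g t $ j) = 0"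
    using system_nontrivial_solution[OF T, of "\<lambda>t j. g t $ j"] by blast
  define u where "u = (\<Sum>t\<in>T. fps_const (x t) * g t)"
  have c: "fps_const y = fps_of_poly [:y:]" for y :: complex by (simp add: fps_of_poly_const)
  have "u \<in> L" unfolding u_def c by (intro sum_mem mult_mem poly_mem g)
  moreover have "u \<in> integral_le q" unfolding u_def c
  proof (rule integral_le_sum)
    fix t assume "t \<in> T"
    then have "fps_of_poly [:x t:] * g t \<in> integral_le (0 + q)" by (intro integral_le_mult integral_le_poly g) auto
    then show "fps_of_poly [:x t:] * g t \<in> integral_le q" by simp
  qed
  moreover have "u $ j = 0" if "j \<le> q * rk" for j
    using x(2) that by (simp add: u_def fps_sum_nth)
  then have "q * rk < subdegree u" if "u \<noteq> 0"
    using that by (intro subdegree_greaterI) auto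
  ultimately have "u = 0" using subdegree_bound[of u q] by fastforce
  with x(1) show ?thesis unfolding u_def by blast
qed

text \<open>Let \<open>b\<close> be an integral basis of growth \<open>c\<close>. Compare the elements \<open>z\<^sup>j b\<^sub>i\<close> and \<open>z\<^sup>j g\<close> of growth at most
  \<open>q + rk c\<close>: there are more of them than the dimension of the space that they lie in, and a linear
  relation between them must involve \<open>g\<close>. The point is that the bound on \<open>degree D\<close> does not depend on \<open>g\<close>
  or \<open>q\<close>.\<close>

lemma bounded_denominator:
  assumes b: "\<And>i. i < rk \<Longrightarrow> b i \<in> L" "\<And>i. i < rk \<Longrightarrow> b i \<in> integral_le c" "\<not> poly_dependent rk b"
    and g: "g \<in> L" "g \<in> integral_le q"
  shows "\<exists>D p. D \<noteq> 0 \<and> degree D \<le> rk * c \<and> (\<forall>i<rk. degree (p i) \<le> q + rk * c) \<and>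
    fps_of_poly D * g = (\<Sum>i<rk. fps_of_poly (p i) * b i)"
proof -
  \<comment> \<open>With \<open>rk (K + 1)\<close> multiples of the basis elements and \<open>rk c + 1\<close> multiples of \<open>g\<close>, the total
    \<open>rk (q + rk c) + rk + 1\<close> exceeds the dimension bound \<open>rk (q + rk c) + 1\<close>.\<close>
  define K where "K = q + rk * c - c"
  have K: "K + c = q + rk * c" using rk_pos by (cases rk) (simp_all add: K_def)
  define A where "A = {..<rk} \<times> {..K}"
  define B where "B = {rk} \<times> {..rk * c}"
  define h where "h = (\<lambda>(i, j). fps_X ^ j * (if i = rk then g else b i))"
  have fin: "finite A" "finite B" "A \<inter> B = {}" by (auto simp: A_def B_def)
  have "rk * K + rk * c = rk * (q + rk * c)" by (simp flip: add_mult_distrib2 add: K)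
  then have card: "(q + rk * c) * rk + 1 < card (A \<union> B)"
    using rk_pos fin by (simp add: card_Un_disjoint) (simp add: A_def B_def algebra_simps)
  have X: "fps_X ^ j = (fps_of_poly (monom 1 j) :: complex fps)" for j by (simp add: fps_of_poly_monom')
  have "\<exists>x. (\<exists>t\<in>A \<union> B. x t \<noteq> 0) \<and> (\<Sum>t\<in>A \<union> B. fps_const (x t) * h t) = 0"
  proof (rule linear_dependence[OF _ card])
    fix t assume t: "t \<in> A \<union> B"
    then show "h t \<in> L"
      unfolding X h_def by (auto simp: A_def B_def intro!: mult_mem poly_mem b g)
    show "h t \<in> integral_le (q + rk * c)"
    proof (cases "t \<in> A")
      case True
      then obtain i j where ij: "t = (i, j)" "i < rk" "j \<le> K" by (auto simp: A_def)
      have "h t \<in> integral_le (j + c)"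
        unfolding X h_def using ij by (auto intro!: integral_le_mult integral_le_poly b degree_monom_le)
      then show ?thesis by (rule integral_le_mono) (use ij K in simp)
    next
      case False
      with t obtain j where j: "t = (rk, j)" "j \<le> rk * c" by (auto simp: B_def)
      have "h t \<in> integral_le (j + q)"
        unfolding X h_def using j by (auto intro!: integral_le_mult integral_le_poly g degree_monom_le)
      then show ?thesis by (rule integral_le_mono) (use j in simp)
    qed
  qed (use fin in simp)
  then obtain x where x: "\<exists>t\<in>A \<union> B. x t \<noteq> 0" "(\<Sum>t\<in>A \<union> B. fps_const (x t) * h t) = 0" by blast
  define p where "p i = (\<Sum>j\<le>K. monom (x (i, j)) j)" for i
  define D where "D = (\<Sum>j\<le>rk * c. monom (x (rk, j)) j)"
  have sA: "(\<Sum>t\<in>A. fps_const (x t) * h t) = (\<Sum>i<rk. fps_of_poly (p i) * b i)"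
  proof -
    have "(\<Sum>t\<in>A. fps_const (x t) * h t) = (\<Sum>i<rk. \<Sum>j\<le>K. fps_const (x (i, j)) * (fps_X ^ j * b i))"
      unfolding A_def sum.cartesian_product by (rule sum.cong) (auto simp: h_def)
    then show ?thesis by (simp add: p_def fps_of_poly_sum fps_of_poly_monom sum_distrib_right mult.assoc)
  qed
  have sB: "(\<Sum>t\<in>B. fps_const (x t) * h t) = fps_of_poly D * g"
  proof -
    have "(\<Sum>t\<in>B. fps_const (x t) * h t) = (\<Sum>i\<in>{rk}. \<Sum>j\<le>rk * c. fps_const (x (i, j)) * (fps_X ^ j * g))"
      unfolding B_def sum.cartesian_product by (rule sum.cong) (auto simp: h_def)
    then show ?thesis by (simp add: D_def fps_of_poly_sum fps_of_poly_monom sum_distrib_right mult.assoc)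
  qed
  have rel: "(\<Sum>i<rk. fps_of_poly (p i) * b i) + fps_of_poly D * g = 0"
    using x(2) fin by (simp add: sum.union_disjoint sA sB)
  have cp: "coeff (p i) j = x (i, j)" if "j \<le> K" for i j using that by (simp add: p_def coeff_sum)
  have cD: "coeff D j = x (rk, j)" if "j \<le> rk * c" for j using that by (simp add: D_def coeff_sum)
  have "D \<noteq> 0"
  proof
    assume D0: "D = 0"
    with rel b(3) have p0: "p i = 0" if "i < rk" for i using that unfolding poly_dependent_def by auto
    obtain t where t: "t \<in> A \<union> B" "x t \<noteq> 0" using x(1) by blast
    then obtain i j where ij: "t = (i, j)" "i < rk \<and> j \<le> K \<or> i = rk \<and> j \<le> rk * c"
      by (auto simp: A_def B_def)
    then have "x t = 0"
      using cp[of j i] cD[of j] p0[of i] D0 by auto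
    with t show False by simp
  qed
  moreover have "degree D \<le> rk * c" by (rule degree_le) (auto simp: D_def coeff_sum)
  moreover have "degree (- p i) \<le> q + rk * c" for i
  proof -
    have "degree (p i) \<le> K" by (rule degree_le) (auto simp: p_def coeff_sum)
    with K show ?thesis by simp
  qed
  moreover have "fps_of_poly D * g = (\<Sum>i<rk. fps_of_poly (- p i) * b i)"
    using rel by (simp add: hom_distribs sum_negf eq_neg_iff_add_eq_0 add.commute)
  ultimately show ?thesis by (intro exI[of _ D] exI[of _ "\<lambda>i. - p i"]) blast
qed

text \<open>The inverse of \<open>u\<close>, up to a polynomial factor, is a polynomial in \<open>u\<close>.\<close>

lemma poly_multiple_of_nonzero:
  assumes "u \<in> L" "u \<noteq> 0" shows "\<exists>t c. t \<in> L \<and> c \<noteq> 0 \<and> t * u = fps_of_poly c"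
proof -
  obtain D q where D: "D \<noteq> 0" "fps_of_poly D * u \<in> integral_le q" using integral_multiple[OF assms(1)] by blast
  let ?w = "fps_of_poly D * u"
  have w: "?w \<in> L" "?w \<noteq> 0" using assms D by (auto intro: mult_mem poly_mem)
  obtain R where "R \<noteq> 0" "degree R \<le> rk" "bipoly_eval R ?w = 0" using annihilator[OF w(1)] by metis
  then obtain P where P: "bipoly_eval P ?w = 0" "coeff P 0 \<noteq> 0"
    using bipoly_eval_monic_min[OF D(2), of R rk] w(2) by metis
  obtain c T where T: "P = pCons c T" by (cases P)
  have "fps_of_poly c = - (?w * bipoly_eval T ?w)" using P(1) T by (simp add: eq_neg_iff_add_eq_0)
  then have "(bipoly_eval T ?w * fps_of_poly (- D)) * u = fps_of_poly c"
    by (simp add: hom_distribs mult_ac)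
  moreover have "bipoly_eval T ?w * fps_of_poly (- D) \<in> L" by (intro mult_mem bipoly_eval_mem poly_mem w)
  ultimately show ?thesis using P(2) T by (intro exI[of _ "bipoly_eval T ?w * fps_of_poly (- D)"] exI[of _ c]) auto
qed

end

section \<open>Rings stable under the substitution and the derivation\<close>

text \<open>The two stability assumptions, on top of finite rank, already force all elements to be rational.\<close>

locale mahler_ring = finite_rank_ring +
  fixes k :: nat
  assumes k: "k \<ge> 2"
    and euler_mem: "f \<in> L \<Longrightarrow> euler f \<in> L"
    and stretch_mem: "f \<in> L \<Longrightarrow> stretch k f \<in> L"
begin

lemma stretch_power_mem: "f \<in> L \<Longrightarrow> stretch (k ^ n) f \<in> L"
proof (induction n)
  case 0
  then show ?case by (simp add: stretch_def)
next
  case (Suc n)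
  then have "stretch k (stretch (k ^ n) f) \<in> L" by (intro stretch_mem)
  then show ?case using k by (simp add: stretch_stretch)
qed

text \<open>Apply \<open>\<delta>\<close> to the coordinates of \<open>g = f(z\<^sup>N)\<close>: a multiple \<open>E D \<delta> g\<close>, with \<open>degree (E D)\<close> bounded by \<open>e\<close>, is
  integral of growth at most \<open>N q + c1\<close>. Neither \<open>e\<close> nor \<open>c1\<close> depends on \<open>N\<close>, so descent from
  \<open>\<delta> g = N (\<delta> f)(z\<^sup>N)\<close> to \<open>\<delta> f\<close> removes both for large \<open>N\<close>.\<close>

lemma euler_integral_le:
  assumes f: "f \<in> L" "f \<in> integral_le q" shows "euler f \<in> integral_le q"
proof -
  obtain b c where b: "\<And>i. i < rk \<Longrightarrow> b i \<in> L" "\<And>i. i < rk \<Longrightarrow> b i \<in> integral_le c" "\<not> poly_dependent rk b"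
    using integral_independent by metis
  obtain E c' where E: "E \<noteq> 0" "\<And>i. i < rk \<Longrightarrow> fps_of_poly E * euler (b i) \<in> integral_le c'"
    using common_integral_multiple[of rk "\<lambda>i. euler (b i)"] b(1) euler_mem by metis
  define l where "l = rk * c"
  define c1 where "c1 = degree E + l + c + c'"
  define e where "e = degree E + l"
  define n where "n = rk * (c1 + e)"
  define N where "N = k ^ n"
  have "n < 2 ^ n" by (rule less_exp)
  also have "\<dots> \<le> N" unfolding N_def using k by (intro power_mono) auto
  finally have N: "rk * (c1 + e) < N" by (simp add: n_def)
  then have N0: "N > 0" by simp
  let ?g = "stretch N f"
  have g: "?g \<in> L" "?g \<in> integral_le (N * q)"
    using stretch_power_mem[OF f(1)] integral_le_stretch[OF N0 f(2)] by (auto simp: N_def)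
  obtain D p where D: "D \<noteq> 0" "degree D \<le> l" "\<And>i. i < rk \<Longrightarrow> degree (p i) \<le> N * q + l"
    "fps_of_poly D * ?g = (\<Sum>i<rk. fps_of_poly (p i) * b i)"
    using bounded_denominator[OF b g] unfolding l_def by metis
  let ?Q = "N * q + c1"
  define S where "S = (\<Sum>i<rk. fps_of_poly (E * poly_euler (p i)) * b i + fps_of_poly (p i) * (fps_of_poly E * euler (b i)))
    + fps_of_poly (- (E * poly_euler D)) * ?g"
  have "fps_of_poly (poly_euler D) * ?g + fps_of_poly D * euler ?g
      = (\<Sum>i<rk. fps_of_poly (poly_euler (p i)) * b i + fps_of_poly (p i) * euler (b i))"
    using arg_cong[OF D(4), of euler] by simp
  then have "fps_of_poly E * (fps_of_poly (poly_euler D) * ?g + fps_of_poly D * euler ?g)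
      = (\<Sum>i<rk. fps_of_poly (E * poly_euler (p i)) * b i + fps_of_poly (p i) * (fps_of_poly E * euler (b i)))"
    by (simp add: sum_distrib_left hom_distribs algebra_simps)
  then have S: "S = fps_of_poly (E * D) * euler ?g"
    by (simp add: S_def hom_distribs algebra_simps)
  have "S \<in> integral_le ?Q"
    unfolding S_def
  proof (intro integral_le_add integral_le_sum)
    fix i assume "i \<in> {..<rk}"
    then have i: "i < rk" by simp
    have "degree (E * poly_euler (p i)) \<le> degree E + (N * q + l)"
      using D(3)[OF i] degree_poly_euler[of "p i"] degree_mult_le[of E "poly_euler (p i)"] by linarith
    then have "fps_of_poly (E * poly_euler (p i)) * b i \<in> integral_le (degree E + (N * q + l) + c)"
      by (intro integral_le_mult integral_le_poly b i)
    then show "fps_of_poly (E * poly_euler (p i)) * b i \<in> integral_le ?Q"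
      by (rule integral_le_mono) (simp add: c1_def)
    have "fps_of_poly (p i) * (fps_of_poly E * euler (b i)) \<in> integral_le (N * q + l + c')"
      by (intro integral_le_mult integral_le_poly D E i)
    then show "fps_of_poly (p i) * (fps_of_poly E * euler (b i)) \<in> integral_le ?Q"
      by (rule integral_le_mono) (simp add: c1_def)
  next
    have "degree (- (E * poly_euler D)) \<le> degree E + l"
      using D(2) degree_poly_euler[of D] degree_mult_le[of E "poly_euler D"] by simp
    then have "fps_of_poly (- (E * poly_euler D)) * ?g \<in> integral_le (degree E + l + N * q)"
      by (intro integral_le_mult integral_le_poly g)
    then show "fps_of_poly (- (E * poly_euler D)) * ?g \<in> integral_le ?Q"
      by (rule integral_le_mono) (simp add: c1_def)
  qed
  then have "fps_of_poly [:1 / of_nat N:] * S \<in> integral_le (0 + ?Q)"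
    by (intro integral_le_mult integral_le_poly) auto
  moreover define u where "u = fps_of_poly (E * D) * stretch N (euler f)"
  have "fps_of_poly [:1 / of_nat N:] * S = u"
  proof -
    have "fps_of_poly [:1 / of_nat N:] * (of_nat N :: complex fps) = 1"
      unfolding fps_of_poly_const fps_of_nat[symmetric] fps_const_mult using N0 by simp
    then show ?thesis unfolding S u_def euler_stretch[OF N0] by (simp add: mult_ac)
  qed
  ultimately have u: "u \<in> integral_le ?Q" by simp
  have "u \<in> L" unfolding u_def N_def by (intro mult_mem poly_mem stretch_power_mem euler_mem f)
  then obtain R where "R \<noteq> 0" "degree R \<le> rk" "bipoly_eval R u = 0" using annihilator by metis
  then obtain P where P: "lead_coeff P = 1" "degree P \<le> rk" "weight_le ?Q (int (?Q * degree P)) P" "bipoly_eval P u = 0"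
    using bipoly_eval_monic_min[OF u, of R rk] by metis
  have "degree (E * D) \<le> e" using D(1,2) E(1) by (simp add: degree_mult_eq e_def)
  with D(1) E(1) show ?thesis
    using P N unfolding u_def by (intro integral_le_descent[of "E * D" e rk c1 N P]) auto
qed

text \<open>The iterates \<open>\<delta>\<^sup>i f\<close> stay in a finite-dimensional space, so \<open>\<chi>(\<delta>) f = 0\<close> for some polynomial \<open>\<chi> \<noteq> 0\<close>.
  On coefficients this reads \<open>\<chi>(n) f\<^sub>n = 0\<close>.\<close>

lemma integral_le_imp_poly:
  assumes f: "f \<in> L" "f \<in> integral_le q" shows "\<exists>p. f = fps_of_poly p"
proof -
  have it: "(euler ^^ i) f \<in> L \<and> (euler ^^ i) f \<in> integral_le q" for i
    by (induction i) (use f in \<open>auto intro: euler_mem euler_integral_le\<close>)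
  let ?T = "{..q * rk + 1}"
  obtain x where x: "\<exists>t\<in>?T. x t \<noteq> 0" "(\<Sum>t\<in>?T. fps_const (x t) * (euler ^^ t) f) = 0"
    using linear_dependence[of ?T q "\<lambda>i. (euler ^^ i) f"] it by auto
  define \<chi> where "\<chi> = (\<Sum>t\<in>?T. monom (x t) t)"
  have "\<chi> \<noteq> 0"
  proof
    assume "\<chi> = 0"
    obtain t where t: "t \<in> ?T" "x t \<noteq> 0" using x(1) by blast
    have "coeff \<chi> t = x t" using t by (simp add: \<chi>_def coeff_sum)
    with \<open>\<chi> = 0\<close> t show False by simp
  qed
  have nth: "(euler ^^ i) f $ n = of_nat n ^ i * f $ n" for i n
    by (induction i) (auto simp: mult_ac)
  have root: "poly \<chi> (of_nat n) * f $ n = 0" for n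
  proof -
    have "poly \<chi> (of_nat n) * f $ n = (\<Sum>t\<in>?T. fps_const (x t) * (euler ^^ t) f) $ n"
      by (simp add: \<chi>_def poly_sum poly_monom fps_sum_nth nth sum_distrib_left sum_distrib_right algebra_simps)
    then show ?thesis by (simp only: x(2) fps_zero_nth)
  qed
  let ?Z = "{n. poly \<chi> (of_nat n :: complex) = 0}"
  have "finite ((of_nat :: nat \<Rightarrow> complex) ` ?Z)"
    by (rule finite_subset[OF _ poly_roots_finite[OF \<open>\<chi> \<noteq> 0\<close>]]) auto
  then have "finite ?Z" by (rule finite_imageD) (simp add: inj_on_def)
  then obtain B where "\<forall>n\<in>?Z. n \<le> B" unfolding finite_nat_set_iff_bounded_le by (rule exE)
  then have B: "n \<le> B" if "poly \<chi> (of_nat n :: complex) = 0" for n using that by simp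
  have "f = fps_of_poly (\<Sum>n\<le>B. monom (f $ n) n)"
  proof (rule fps_ext)
    fix n
    have "f $ n = 0" if "n > B" using root[of n] B[of n] that by auto
    then show "f $ n = fps_of_poly (\<Sum>n\<le>B. monom (f $ n) n) $ n" by (auto simp: coeff_sum not_le)
  qed
  then show ?thesis ..
qed

theorem mem_imp_rational:
  assumes "f \<in> L" shows "\<exists>D p. D \<noteq> 0 \<and> fps_of_poly D * f = fps_of_poly p"
proof -
  obtain D q where "D \<noteq> 0" "fps_of_poly D * f \<in> integral_le q" using integral_multiple[OF assms] by blast
  moreover from this have "\<exists>p. fps_of_poly D * f = fps_of_poly p"
    by (intro integral_le_imp_poly) (auto intro: mult_mem poly_mem assms)
  ultimately show ?thesis by blast
qed

end

section \<open>The ring generated by an algebraic Mahler function\<close>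

text \<open>The power series in the \<open>\<complex>(z)\<close>-span of the family \<open>g\<close>.\<close>

definition saturated_span :: "'i set \<Rightarrow> ('i \<Rightarrow> complex fps) \<Rightarrow> complex fps set" where
  "saturated_span I g = {y. \<exists>D p. D \<noteq> 0 \<and> fps_of_poly D * y = (\<Sum>i\<in>I. fps_of_poly (p i) * g i)}"

lemma saturated_spanI: "D \<noteq> 0 \<Longrightarrow> fps_of_poly D * y = (\<Sum>i\<in>I. fps_of_poly (p i) * g i) \<Longrightarrow> y \<in> saturated_span I g"
  unfolding saturated_span_def by blast

lemma saturated_spanE:
  assumes "y \<in> saturated_span I g"
  obtains D p where "D \<noteq> 0" "fps_of_poly D * y = (\<Sum>i\<in>I. fps_of_poly (p i) * g i)"
  using assms unfolding saturated_span_def by blast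

lemma saturated_span_add:
  assumes "y \<in> saturated_span I g" "z \<in> saturated_span I g" shows "y + z \<in> saturated_span I g"
proof -
  obtain D p where y: "D \<noteq> 0" "fps_of_poly D * y = (\<Sum>i\<in>I. fps_of_poly (p i) * g i)"
    using assms(1) by (rule saturated_spanE)
  obtain E r where z: "E \<noteq> 0" "fps_of_poly E * z = (\<Sum>i\<in>I. fps_of_poly (r i) * g i)"
    using assms(2) by (rule saturated_spanE)
  have "fps_of_poly (D * E) * (y + z) = fps_of_poly E * (fps_of_poly D * y) + fps_of_poly D * (fps_of_poly E * z)"
    by (simp add: hom_distribs algebra_simps)
  also have "\<dots> = (\<Sum>i\<in>I. fps_of_poly (E * p i + D * r i) * g i)"
    unfolding y z by (simp add: sum_distrib_left hom_distribs algebra_simps sum.distrib)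
  finally show ?thesis using y(1) z(1) by (intro saturated_spanI[of "D * E"]) auto
qed

lemma saturated_span_scale:
  assumes "y \<in> saturated_span I g" shows "fps_of_poly c * y \<in> saturated_span I g"
proof -
  obtain D p where y: "D \<noteq> 0" "fps_of_poly D * y = (\<Sum>i\<in>I. fps_of_poly (p i) * g i)"
    using assms(1) by (rule saturated_spanE)
  have "fps_of_poly D * (fps_of_poly c * y) = fps_of_poly c * (fps_of_poly D * y)" by (simp add: mult_ac)
  also have "\<dots> = (\<Sum>i\<in>I. fps_of_poly (c * p i) * g i)"
    unfolding y by (simp add: sum_distrib_left hom_distribs mult_ac)
  finally show ?thesis using y(1) by (rule saturated_spanI[rotated])
qed

lemma saturated_span_saturated:
  assumes "fps_of_poly c * y \<in> saturated_span I g" "c \<noteq> 0" shows "y \<in> saturated_span I g"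
proof -
  obtain D p where y: "D \<noteq> 0" "fps_of_poly D * (fps_of_poly c * y) = (\<Sum>i\<in>I. fps_of_poly (p i) * g i)"
    using assms(1) by (rule saturated_spanE)
  then show ?thesis using assms(2) by (intro saturated_spanI[of "D * c" _ p]) (auto simp: hom_distribs mult_ac)
qed

lemma saturated_span_0: "0 \<in> saturated_span I g"
  by (rule saturated_spanI[of 1 _ "\<lambda>_. 0"]) auto

lemma saturated_span_sum: "(\<And>x. x \<in> A \<Longrightarrow> f x \<in> saturated_span I g) \<Longrightarrow> sum f A \<in> saturated_span I g"
  by (induction A rule: infinite_finite_induct) (auto intro: saturated_span_add saturated_span_0)

lemma saturated_span_generator:
  assumes "finite I" "i \<in> I" shows "g i \<in> saturated_span I g"
proof (rule saturated_spanI[of 1 _ "\<lambda>j. if j = i then 1 else 0"])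
  have "(\<Sum>j\<in>I. fps_of_poly (if j = i then 1 else 0) * g j) = (\<Sum>j\<in>I. if j = i then g j else 0)"
    by (rule sum.cong) auto
  with assms show "fps_of_poly 1 * g i = (\<Sum>j\<in>I. fps_of_poly (if j = i then 1 else 0) * g j)" by simp
qed simp

lemma saturated_span_mult:
  assumes gens: "\<And>i j. i \<in> I \<Longrightarrow> j \<in> I \<Longrightarrow> g i * g j \<in> saturated_span I g"
    and "y \<in> saturated_span I g" "z \<in> saturated_span I g" shows "y * z \<in> saturated_span I g"
proof -
  obtain D p where y: "D \<noteq> 0" "fps_of_poly D * y = (\<Sum>i\<in>I. fps_of_poly (p i) * g i)"
    using assms(2) by (rule saturated_spanE)
  obtain E r where z: "E \<noteq> 0" "fps_of_poly E * z = (\<Sum>i\<in>I. fps_of_poly (r i) * g i)"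
    using assms(3) by (rule saturated_spanE)
  have "fps_of_poly (D * E) * (y * z) = (fps_of_poly D * y) * (fps_of_poly E * z)"
    by (simp add: hom_distribs mult_ac)
  also have "\<dots> = (\<Sum>i\<in>I. \<Sum>j\<in>I. fps_of_poly (p i * r j) * (g i * g j))"
    unfolding y z sum_product by (simp add: hom_distribs mult_ac)
  also have "\<dots> \<in> saturated_span I g" by (intro saturated_span_sum saturated_span_scale gens)
  finally show ?thesis by (rule saturated_span_saturated) (use y z in auto)
qed

lemma saturated_span_stretch:
  assumes N: "N > 0" and gens: "\<And>i. i \<in> I \<Longrightarrow> stretch N (g i) \<in> saturated_span I g"
    and "y \<in> saturated_span I g" shows "stretch N y \<in> saturated_span I g"
proof -
  obtain D p where y: "D \<noteq> 0" "fps_of_poly D * y = (\<Sum>i\<in>I. fps_of_poly (p i) * g i)"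
    using assms(3) by (rule saturated_spanE)
  have "fps_of_poly (poly_stretch N D) * stretch N y = stretch N (fps_of_poly D * y)" using N by simp
  also have "\<dots> = (\<Sum>i\<in>I. fps_of_poly (poly_stretch N (p i)) * stretch N (g i))" unfolding y using N by simp
  also have "\<dots> \<in> saturated_span I g" by (intro saturated_span_sum saturated_span_scale gens)
  finally show ?thesis by (rule saturated_span_saturated) (use y N in simp)
qed

lemma saturated_span_euler:
  assumes gens: "\<And>i. i \<in> I \<Longrightarrow> euler (g i) \<in> saturated_span I g" and fin: "finite I"
    and "y \<in> saturated_span I g" shows "euler y \<in> saturated_span I g"
proof -
  obtain D p where y: "D \<noteq> 0" "fps_of_poly D * y = (\<Sum>i\<in>I. fps_of_poly (p i) * g i)"
    using assms(3) by (rule saturated_spanE)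
  have "fps_of_poly D * euler y = (\<Sum>i\<in>I. fps_of_poly (poly_euler (p i)) * g i + fps_of_poly (p i) * euler (g i))
      + fps_of_poly (- poly_euler D) * y"
    using arg_cong[OF y(2), of euler] by (simp add: hom_distribs algebra_simps)
  also have "\<dots> \<in> saturated_span I g"
    by (intro saturated_span_sum saturated_span_add saturated_span_scale gens saturated_span_generator fin assms(3))
  finally show ?thesis by (rule saturated_span_saturated) (use y in simp)
qed

lemma saturated_span_rank:
  assumes fin: "finite I" and x: "\<And>i. i \<le> card I \<Longrightarrow> x i \<in> saturated_span I g"
  shows "poly_dependent (Suc (card I)) x"
proof -
  obtain h where h: "bij_betw h {..<card I} I"
    using ex_bij_betw_nat_finite[OF fin] by (auto simp: atLeast0LessThan)
  have "\<forall>i. \<exists>D p. i \<le> card I \<longrightarrow> D \<noteq> 0 \<and> fps_of_poly D * x i = (\<Sum>j\<in>I. fps_of_poly (p j) * g j)"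
    using x unfolding saturated_span_def by blast
  then obtain D p where Dp: "\<And>i. i \<le> card I \<Longrightarrow> D i \<noteq> 0"
    "\<And>i. i \<le> card I \<Longrightarrow> fps_of_poly (D i) * x i = (\<Sum>j\<in>I. fps_of_poly (p i j) * g j)" by metis
  let ?T = "{..<Suc (card I)}"
  obtain y where y: "\<exists>i\<in>?T. y i \<noteq> 0" "\<forall>l<card I. (\<Sum>i\<in>?T. y i * p i (h l)) = 0"
    using system_nontrivial_solution[of ?T "card I" "\<lambda>i l. p i (h l)"] by auto
  have y0: "(\<Sum>i\<in>?T. y i * p i j) = 0" if j: "j \<in> I" for j
  proof -
    have "j \<in> h ` {..<card I}" using j by (simp add: bij_betw_imp_surj_on[OF h])
    then obtain l where "l < card I" "h l = j" by auto
    with y(2) show ?thesis by blast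
  qed
  have "(\<Sum>i\<in>?T. fps_of_poly (y i * D i) * x i) = (\<Sum>i\<in>?T. fps_of_poly (y i) * (\<Sum>j\<in>I. fps_of_poly (p i j) * g j))"
    by (rule sum.cong) (use Dp(2) in \<open>auto simp: hom_distribs mult.assoc\<close>)
  also have "\<dots> = (\<Sum>j\<in>I. fps_of_poly (\<Sum>i\<in>?T. y i * p i j) * g j)"
    unfolding sum_distrib_left by (subst sum.swap) (simp add: fps_of_poly_sum sum_distrib_right hom_distribs mult_ac del: sum.lessThan_Suc)
  also have "\<dots> = 0" using y0 by (simp del: sum.lessThan_Suc)
  finally have "(\<Sum>i\<in>?T. fps_of_poly (y i * D i) * x i) = 0" .
  moreover have "\<exists>i<Suc (card I). y i * D i \<noteq> 0" using y(1) Dp(1) by fastforce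
  ultimately show ?thesis unfolding poly_dependent_def by (intro exI[of _ "\<lambda>i. y i * D i"] conjI)
qed

text \<open>Division of \<open>X\<^sup>j\<close> by an annihilator of \<open>u\<close>.\<close>

lemma algebraic_power_reduce:
  assumes R: "R \<noteq> 0" "bipoly_eval R u = 0" "degree R \<le> n"
  shows "\<exists>a p. a \<noteq> 0 \<and> fps_of_poly a * u ^ j = (\<Sum>l<n. fps_of_poly (p l) * u ^ l)"
proof -
  let ?r = "pseudo_mod (monom 1 j) R"
  obtain a q where a: "a \<noteq> 0" "Polynomial.smult a (monom 1 j) = R * q + ?r"
    using pseudo_mod(1)[OF R(1), of "monom 1 j"] by auto
  have "degree R > 0"
  proof (rule ccontr)
    assume "\<not> degree R > 0"
    then obtain c where "R = [:c:]" by (metis degree_eq_zeroE neq0_conv)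
    with R show False by simp
  qed
  with pseudo_mod(2)[OF R(1), of "monom 1 j"] R(3) have d: "degree ?r < n" by auto
  have m: "bipoly_eval (monom 1 j) u = u ^ j"
  proof -
    have "bipoly_eval (monom 1 j) u = (\<Sum>i\<le>j. if i = j then u ^ i else 0)"
      unfolding bipoly_eval_altdef[OF order_refl] degree_monom_eq[OF one_neq_zero] by (rule sum.cong) auto
    then show ?thesis by simp
  qed
  have "fps_of_poly a * u ^ j = bipoly_eval ?r u"
    using arg_cong[OF a(2), of "\<lambda>P. bipoly_eval P u"] R(2) m by simp
  also have "\<dots> = (\<Sum>l\<le>n - 1. fps_of_poly (coeff ?r l) * u ^ l)"
    by (rule bipoly_eval_altdef) (use d in simp)
  also have "{..n - 1} = {..<n}" using d by auto
  finally show ?thesis using a(1) by blast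
qed

text \<open>The ring is spanned by the monomials in \<open>F, \<sigma> F, \<dots>, \<sigma>\<^bsup>d-1\<^esup> F\<close> with exponents below the degree of \<open>F\<close>. The
  functional equation makes it stable under \<open>\<sigma>\<close>. It contains \<open>\<delta> F\<close>, because the derivative of an
  algebraic function is a rational expression in that function, and hence all \<open>\<delta> (\<sigma>\<^sup>i F) = k\<^sup>i \<sigma>\<^sup>i (\<delta> F)\<close>.\<close>

lemma algebraic_mahler_rational:
  assumes k: "k \<ge> 2" and d: "d \<ge> 1" and ad: "a d \<noteq> 0"
    and mahler: "(\<Sum>i = 0..d. fps_of_poly (a i) * stretch (k ^ i) F) = 0"
    and R: "R \<noteq> 0" "bipoly_eval R F = 0"
  shows "\<exists>D p. D \<noteq> 0 \<and> fps_of_poly D * F = fps_of_poly p"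
proof -
  define n where "n = degree R"
  define x where "x i = stretch (k ^ i) F" for i
  define I where "I = (PiE {..<d} (\<lambda>_. {..<n}) :: (nat \<Rightarrow> nat) set)"
  define mono where "mono e = (\<Prod>i<d. x i ^ e i)" for e :: "nat \<Rightarrow> nat"
  define L where "L = saturated_span I mono"
  have kp: "k ^ i > 0" for i using k by simp
  have fin: "finite I" by (simp add: I_def finite_PiE)
  have mono_mem: "mono e \<in> L" for e
  proof -
    have "\<exists>a p. a \<noteq> 0 \<and> fps_of_poly a * x i ^ e i = (\<Sum>l<n. fps_of_poly (p l) * x i ^ l)" for i
    proof (rule algebraic_power_reduce)
      show "bipoly_eval (map_poly (poly_stretch (k ^ i)) R) (x i) = 0"
        using stretch_bipoly_eval[OF kp, of i R F] R(2) k by (simp add: x_def)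
      show "map_poly (poly_stretch (k ^ i)) R \<noteq> 0" using R(1) poly_stretch_eq_0_iff[OF kp, of i]
        by (metis coeff_0 coeff_map_poly leading_coeff_0_iff poly_stretch_0)
      show "degree (map_poly (poly_stretch (k ^ i)) R) \<le> n" unfolding n_def by (rule degree_map_poly_le)
    qed
    then obtain D p where D: "\<And>i. D i \<noteq> 0"
      "\<And>i. fps_of_poly (D i) * x i ^ e i = (\<Sum>l<n. fps_of_poly (p i l) * x i ^ l)" by metis
    have "fps_of_poly (\<Prod>i<d. D i) * mono e = (\<Prod>i<d. fps_of_poly (D i) * x i ^ e i)"
      by (simp add: mono_def fps_of_poly_prod prod.distrib)
    also have "\<dots> = (\<Prod>i<d. \<Sum>l<n. fps_of_poly (p i l) * x i ^ l)" by (simp add: D)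
    also have "\<dots> = (\<Sum>g\<in>I. \<Prod>i<d. fps_of_poly (p i (g i)) * x i ^ g i)"
      unfolding I_def by (rule prod_sum_PiE) auto
    also have "\<dots> = (\<Sum>g\<in>I. fps_of_poly (\<Prod>i<d. p i (g i)) * mono g)"
      by (simp add: mono_def fps_of_poly_prod prod.distrib)
    finally show ?thesis unfolding L_def by (rule saturated_spanI[rotated]) (use D in simp)
  qed
  have add: "y \<in> L \<Longrightarrow> z \<in> L \<Longrightarrow> y + z \<in> L" for y z unfolding L_def by (rule saturated_span_add)
  have mult: "y * z \<in> L" if "y \<in> L" "z \<in> L" for y z
    unfolding L_def
  proof (rule saturated_span_mult)
    fix e e'
    have "mono e * mono e' = mono (\<lambda>i. e i + e' i)"
      by (simp add: mono_def power_add prod.distrib)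
    then show "mono e * mono e' \<in> saturated_span I mono" using mono_mem by (simp add: L_def)
  qed (use that in \<open>simp_all add: L_def\<close>)
  have poly: "fps_of_poly p \<in> L" for p
    using saturated_span_scale[OF mono_mem[of "\<lambda>_. 0", unfolded L_def], of p] by (simp add: L_def mono_def)
  interpret L: finite_rank_ring L
  proof
    show "\<exists>s. \<forall>x. (\<forall>i\<le>s. x i \<in> L) \<longrightarrow> poly_dependent (Suc s) x"
      using saturated_span_rank[OF fin, of _ mono] unfolding L_def by blast
  qed (simp_all add: poly add mult)
  have x_mem: "x i \<in> L" if "i < d" for i
  proof -
    have "mono (\<lambda>l. if l = i then 1 else 0) = (\<Prod>l<d. if l = i then x l else 1)"
      unfolding mono_def by (rule prod.cong) auto
    also have "\<dots> = x i" using that by simp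
    finally show ?thesis using mono_mem by metis
  qed
  have xd: "x d \<in> L"
  proof -
    have "(\<Sum>i<d. fps_of_poly (a i) * x i) + fps_of_poly (a d) * x d = 0"
      using mahler unfolding x_def atLeast0AtMost lessThan_Suc_atMost[symmetric] by simp
    then have "fps_of_poly (a d) * x d = - (\<Sum>i<d. fps_of_poly (a i) * x i)"
      by (simp add: eq_neg_iff_add_eq_0 add.commute)
    also have "\<dots> = (\<Sum>i<d. fps_of_poly (- a i) * x i)" by (simp add: hom_distribs sum_negf)
    also have "\<dots> \<in> L" by (intro L.sum_mem mult poly x_mem) simp
    finally show ?thesis unfolding L_def by (rule saturated_span_saturated[OF _ ad])
  qed
  have stretch_L: "stretch k y \<in> L" if "y \<in> L" for y
    unfolding L_def
  proof (rule saturated_span_stretch)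
    fix e
    have "stretch k (mono e) = (\<Prod>i<d. x (Suc i) ^ e i)"
      using k by (simp add: mono_def x_def stretch_stretch)
    also have "\<dots> \<in> L"
    proof -
      have xS: "x (Suc i) \<in> L" if "i < d" for i
        using x_mem[of "Suc i"] xd that by (cases "Suc i = d") auto
      have "(\<Prod>i\<in>A. x (Suc i) ^ e i) \<in> L" if "A \<subseteq> {..<d}" for A
        using finite_subset[OF that finite_lessThan] that
        by (induction A rule: finite_induct) (auto intro!: mult L.power_mem L.one_mem xS)
      then show ?thesis by blast
    qed
    finally show "stretch k (mono e) \<in> saturated_span I mono" by (simp add: L_def)
  qed (use that k in \<open>simp_all add: L_def\<close>)
  have stretch_pow: "stretch (k ^ i) y \<in> L" if "y \<in> L" for i y
  proof (induction i)
    case 0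
    then show ?case using that by (simp add: stretch_def)
  next
    case (Suc i)
    then have "stretch k (stretch (k ^ i) y) \<in> L" by (intro stretch_L)
    then show ?case using k by (simp add: stretch_stretch)
  qed
  have F: "F \<in> L" using x_mem[of 0] d by (simp add: x_def stretch_def)
  have euler_F: "euler F \<in> L"
  proof -
    \<comment> \<open>Differentiate an equation \<open>S(F) = 0\<close> of least degree. The factor \<open>S'(F)\<close> of \<open>\<delta> F\<close> is then nonzero, and it
      has an inverse in the ring up to a polynomial.\<close>
    let ?ann = "\<lambda>n. \<exists>R. R \<noteq> 0 \<and> degree R = n \<and> bipoly_eval R F = 0"
    define n0 where "n0 = (LEAST n. ?ann n)"
    have "?ann n0" unfolding n0_def by (rule LeastI[of ?ann "degree R"]) (use R in auto)
    then obtain S where S: "S \<noteq> 0" "degree S = n0" "bipoly_eval S F = 0" by auto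
    have least: "n0 \<le> degree T" if "T \<noteq> 0" "bipoly_eval T F = 0" for T
      unfolding n0_def by (rule Least_le) (use that in auto)
    have dS: "degree S > 0"
    proof (rule ccontr)
      assume "\<not> degree S > 0"
      then obtain c where "S = [:c:]" by (metis degree_eq_zeroE neq0_conv)
      with S show False by simp
    qed
    have "pderiv S \<noteq> 0" using dS by (simp add: pderiv_eq_0_iff)
    moreover have "degree (pderiv S) < n0" using dS S(2) by (simp add: degree_pderiv)
    ultimately have nz: "bipoly_eval (pderiv S) F \<noteq> 0" using least by force
    have "euler (bipoly_eval T F) = bipoly_eval (map_poly poly_euler T) F + bipoly_eval (pderiv T) F * euler F" for T
    proof (induction T)
      case (pCons c T)
      have "map_poly poly_euler (pCons c T) = pCons (poly_euler c) (map_poly poly_euler T)"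
        by (rule map_poly_pCons) (use pCons.hyps in auto)
      with pCons show ?case by (simp add: pderiv_pCons algebra_simps)
    qed simp
    from this[of S] have eq: "bipoly_eval (pderiv S) F * euler F = - bipoly_eval (map_poly poly_euler S) F"
      using S(3) by (simp add: eq_neg_iff_add_eq_0 add.commute)
    obtain t c where t: "t \<in> L" "c \<noteq> 0" "t * bipoly_eval (pderiv S) F = fps_of_poly c"
      using L.poly_multiple_of_nonzero[OF L.bipoly_eval_mem[OF F] nz] by metis
    have "fps_of_poly c * euler F = t * (bipoly_eval (pderiv S) F * euler F)" by (simp add: mult.assoc flip: t(3))
    also have "\<dots> = t * (fps_of_poly (-1) * bipoly_eval (map_poly poly_euler S) F)" unfolding eq by (simp add: hom_distribs)
    also have "\<dots> \<in> L" by (intro mult poly L.bipoly_eval_mem F t)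
    finally show ?thesis unfolding L_def by (rule saturated_span_saturated[OF _ t(2)])
  qed
  have euler_x: "euler (x i) \<in> L" for i
  proof -
    have "euler (x i) = fps_of_poly (of_nat (k ^ i)) * stretch (k ^ i) (euler F)"
      unfolding x_def using euler_stretch[OF kp, of i F] by (simp add: hom_distribs)
    then show ?thesis using stretch_pow[OF euler_F, of i] poly mult by metis
  qed
  have euler_L: "euler y \<in> L" if "y \<in> L" for y
    unfolding L_def
  proof (rule saturated_span_euler[OF _ fin])
    fix e
    have pw: "euler (z ^ j) \<in> L" if "z \<in> L" "euler z \<in> L" for z j
      by (induction j) (use that in \<open>auto intro!: add mult L.power_mem simp: L.zero_mem\<close>)
    have "(\<Prod>i\<in>A. x i ^ e i) \<in> L \<and> euler (\<Prod>i\<in>A. x i ^ e i) \<in> L" if "A \<subseteq> {..<d}" for A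
      using finite_subset[OF that finite_lessThan] that
    proof (induction A rule: finite_induct)
      case (insert i A)
      then have "x i \<in> L" by (intro x_mem) simp
      with insert show ?case
        by (simp add: add mult L.power_mem pw euler_x)
    qed (simp add: L.one_mem L.zero_mem)
    then show "euler (mono e) \<in> saturated_span I mono" by (simp add: mono_def flip: L_def)
  qed (use that in \<open>simp add: L_def\<close>)
  interpret mahler_ring L k
    by unfold_locales (use k in \<open>auto intro: stretch_L euler_L\<close>)
  show ?thesis by (rule mem_imp_rational[OF F])
qed

section \<open>The rank of the Hankel matrix\<close>

text \<open>A maximal independent set \<open>S\<close> of columns has fewer than \<open>n\<close> elements, so some nonzero \<open>x\<close> is orthogonal to
  \<open>S\<close>, and thereby to all columns.\<close>

lemma (in vec_space) rank_deficient_imp_left_kernel: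
  fixes A :: "'a mat"
  assumes A: "A \<in> carrier_mat n nc" and r: "rank A \<noteq> n"
  shows "\<exists>x. (\<exists>i<n. x i \<noteq> 0) \<and> (\<forall>j<nc. (\<Sum>i<n. x i * A $$ (i, j)) = 0)"
proof -
  let ?P = "\<lambda>T. T \<subseteq> set (cols A) \<and> lin_indpt T"
  obtain S where S: "finite S" "maximal S ?P"
    using maximal_exists_superset[of "set (cols A)" ?P "{}"] by (auto simp: lin_dep_def)
  have Ss: "S \<subseteq> set (cols A)" "lin_indpt S" using S(2) by (auto simp: maximal_def)
  have cA: "set (cols A) \<subseteq> carrier_vec n" using cols_dim A by blast
  have "card S \<le> n" using li_le_dim(2)[OF fin_dim _ Ss(2)] Ss(1) cA dim_is_n by auto
  with rank_card_indpt[OF A S(2)] r have card: "card S < n" by simp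
  obtain h where h: "bij_betw h {..<card S} S"
    using ex_bij_betw_nat_finite[OF S(1)] by (auto simp: atLeast0LessThan)
  obtain x where x: "\<exists>i\<in>{..<n}. x i \<noteq> 0" "\<forall>j<card S. (\<Sum>i\<in>{..<n}. x i * h j $ i) = 0"
    using system_nontrivial_solution[of "{..<n}" "card S" "\<lambda>i j. h j $ i"] card by auto
  have xS: "(\<Sum>i<n. x i * s $ i) = 0" if s: "s \<in> S" for s :: "'a vec"
  proof -
    have "s \<in> h ` {..<card S}" using s by (simp add: bij_betw_imp_surj_on[OF h])
    then obtain j where "j < card S" "h j = s" by auto
    with x(2) show ?thesis by blast
  qed
  have xcol: "(\<Sum>i<n. x i * s $ i) = 0" if s: "s \<in> set (cols A)" for s :: "'a vec"
  proof (cases "s \<in> S")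
    case False
    have fin: "finite (insert s S)" using S(1) by simp
    have sub: "insert s S \<subseteq> carrier_vec n" using s Ss(1) cA by auto
    have dep: "lin_dep (insert s S)"
    proof (rule ccontr)
      assume "\<not> lin_dep (insert s S)"
      with s Ss(1) have "?P (insert s S)" by auto
      with S(2) False show False unfolding maximal_def by blast
    qed
    obtain a v where a: "lincomb a (insert s S) = 0\<^sub>v n" "v \<in> insert s S" "a v \<noteq> 0"
      using finite_lin_dep[OF fin dep] sub by auto
    have comp: "a s * s $ i + (\<Sum>t\<in>S. a t * t $ i) = 0" if i: "i < n" for i
      using arg_cong[OF a(1), of "\<lambda>v. vec_index v i"] lincomb_index[OF i sub, of a] i False S(1) by simp
    have as: "a s \<noteq> 0"
    proof
      assume as: "a s = 0"
      have "lincomb a S = 0\<^sub>v n"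
      proof (rule eq_vecI)
        fix i assume "i < dim_vec (0\<^sub>v n)"
        then have i: "i < n" by simp
        show "lincomb a S $ i = 0\<^sub>v n $ i"
          using comp[OF i] lincomb_index[OF i, of S a] sub as i by simp
      qed (use lincomb_dim[OF S(1)] sub in auto)
      moreover have "v \<in> S" using a as by auto
      ultimately have "lin_dep S" using a(3) by (intro lin_dep_crit[where A = S and a = a and v = v]) (use S(1) in auto)
      with Ss(2) show False ..
    qed
    have "0 = (\<Sum>i<n. x i * (a s * s $ i + (\<Sum>t\<in>S. a t * t $ i)))" using comp by simp
    also have "\<dots> = a s * (\<Sum>i<n. x i * s $ i) + (\<Sum>i<n. \<Sum>t\<in>S. x i * (a t * t $ i))"
      by (simp add: sum_distrib_left distrib_left sum.distrib mult_ac)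
    also have "(\<Sum>i<n. \<Sum>t\<in>S. x i * (a t * t $ i)) = (\<Sum>t\<in>S. a t * (\<Sum>i<n. x i * t $ i))"
      by (subst sum.swap) (simp add: sum_distrib_left mult_ac)
    also have "\<dots> = 0" using xS by simp
    finally show ?thesis using as by simp
  qed (rule xS)
  have "(\<Sum>i<n. x i * A $$ (i, j)) = 0" if j: "j < nc" for j
  proof -
    have "col A j \<in> set (cols A)" using j A by (auto simp: cols_def)
    from xcol[OF this] show ?thesis using j A by simp
  qed
  with x(1) show ?thesis by blast
qed

text \<open>For full rank, \<open>n\<close> independent columns would form an invertible matrix with a left kernel vector.\<close>

lemma (in vec_space) left_kernel_imp_rank_deficient:
  fixes A :: "'a mat"
  assumes A: "A \<in> carrier_mat n nc" and x: "\<exists>i<n. x i \<noteq> 0"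
    and ker: "\<And>j. j < nc \<Longrightarrow> (\<Sum>i<n. x i * A $$ (i, j)) = 0"
  shows "rank A \<noteq> n"
proof
  assume r: "rank A = n"
  let ?P = "\<lambda>T. T \<subseteq> set (cols A) \<and> lin_indpt T"
  obtain S where S: "finite S" "maximal S ?P"
    using maximal_exists_superset[of "set (cols A)" ?P "{}"] by (auto simp: lin_dep_def)
  have Ss: "S \<subseteq> set (cols A)" "lin_indpt S" using S(2) by (auto simp: maximal_def)
  have cA: "set (cols A) \<subseteq> carrier_vec n" using cols_dim A by blast
  have card: "card S = n" using rank_card_indpt[OF A S(2)] r by simp
  obtain ss where ss: "set ss = S" "distinct ss" using finite_distinct_list[OF S(1)] by auto
  have len: "length ss = n" using ss card distinct_card by metis
  define B where "B = mat_of_cols n ss"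
  have B: "B \<in> carrier_mat n n" by (simp add: B_def len flip: len)
  have cB: "cols B = ss" unfolding B_def by (rule cols_mat_of_cols) (use ss Ss cA in auto)
  have "rank B = n" by (rule lin_indpt_full_rank[OF B]) (use ss Ss in \<open>simp_all add: cB\<close>)
  then have "det B \<noteq> 0" using det_rank_iff[OF B] by simp
  then have dT: "det (transpose_mat B) \<noteq> 0" using det_transpose[OF B] by simp
  have BT: "transpose_mat B \<in> carrier_mat n n" using B by simp
  have "transpose_mat B *\<^sub>v vec n x = 0\<^sub>v n"
  proof (rule eq_vecI)
    fix l assume "l < dim_vec (0\<^sub>v n :: 'a vec)"
    then have l: "l < n" by simp
    then have "ss ! l \<in> set (cols A)" using ss(1) Ss(1) len nth_mem by blast
    then obtain j where j: "j < nc" "ss ! l = col A j"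
      using A by (auto simp: cols_def)
    have "(transpose_mat B *\<^sub>v vec n x) $ l = (\<Sum>i = 0..<n. B $$ (i, l) * x i)"
      using l B by (simp add: scalar_prod_def)
    also have "\<dots> = (\<Sum>i<n. x i * A $$ (i, j))"
      unfolding atLeast0LessThan
    proof (rule sum.cong[OF refl])
      fix i assume "i \<in> {..<n}"
      then have i: "i < n" by simp
      have "B $$ (i, l) = (ss ! l) $ i" using i l len by (simp add: B_def mat_of_cols_index)
      then show "B $$ (i, l) * x i = x i * A $$ (i, j)" using i j A by (simp add: mult.commute)
    qed
    also have "\<dots> = 0" by (rule ker[OF j(1)])
    finally show "(transpose_mat B *\<^sub>v vec n x) $ l = 0\<^sub>v n $ l" using l by simp
  qed (use B in auto)
  moreover have "vec n x \<noteq> 0\<^sub>v n" using x by (metis index_vec index_zero_vec(1))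
  ultimately show False using dT det_0_iff_vec_prod_zero_field[OF BT] by (metis vec_carrier)
qed

text \<open>A combination of rows of the Hankel matrix is a window of coefficients of the product \<open>Q F\<close>.\<close>

lemma left_kernel_nth:
  fixes F :: "complex fps"
  assumes "\<And>i. i \<le> \<kappa> \<Longrightarrow> x i = coeff Q (\<kappa> - i)" "degree Q \<le> \<kappa>"
  shows "(\<Sum>i\<le>\<kappa>. x i * F $ (i + j)) = (fps_of_poly Q * F) $ (\<kappa> + j)"
proof -
  have "(fps_of_poly Q * F) $ (\<kappa> + j) = (\<Sum>l\<le>\<kappa> + j. coeff Q l * F $ (\<kappa> + j - l))"
    by (simp add: fps_mult_nth atLeast0AtMost)
  also have "\<dots> = (\<Sum>l\<le>\<kappa>. coeff Q l * F $ (\<kappa> + j - l))"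
    by (rule sum.mono_neutral_right) (use assms(2) in \<open>auto simp: coeff_eq_0\<close>)
  also have "\<dots> = (\<Sum>i\<le>\<kappa>. x i * F $ (i + j))"
    by (rule sum.reindex_bij_witness[of _ "\<lambda>i. \<kappa> - i" "\<lambda>i. \<kappa> - i"]) (auto simp: assms(1))
  finally show ?thesis ..
qed

lemma hankel_rank_deficient_iff:
  "vec_space.rank (1 + \<kappa>) (hankel_mat (1 + \<kappa>) N F) \<noteq> 1 + \<kappa> \<longleftrightarrow>
    (\<exists>Q. Q \<noteq> 0 \<and> degree Q \<le> \<kappa> \<and> (\<forall>j<N. (fps_of_poly Q * F) $ (\<kappa> + j) = 0))"
    (is "?l \<longleftrightarrow> ?r")
proof -
  interpret vec_space "TYPE(complex)" "1 + \<kappa>" .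
  let ?M = "hankel_mat (1 + \<kappa>) N F"
  have M: "?M \<in> carrier_mat (1 + \<kappa>) N" by (simp add: hankel_mat_def)
  have ent: "?M $$ (i, j) = F $ (i + j)" if "i < 1 + \<kappa>" "j < N" for i j
    using that by (simp add: hankel_mat_def)
  have sum_eq: "(\<Sum>i<1 + \<kappa>. x i * ?M $$ (i, j)) = (\<Sum>i\<le>\<kappa>. x i * F $ (i + j))" if "j < N" for x j
    by (rule sum.cong) (use that ent in auto)
  show ?thesis
  proof
    assume ?l
    then obtain x where x: "\<exists>i<1 + \<kappa>. x i \<noteq> 0" "\<forall>j<N. (\<Sum>i<1 + \<kappa>. x i * ?M $$ (i, j)) = 0"
      using rank_deficient_imp_left_kernel[OF M] by blast
    define Q where "Q = (\<Sum>l\<le>\<kappa>. monom (x (\<kappa> - l)) l)"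
    have c: "coeff Q l = (if l \<le> \<kappa> then x (\<kappa> - l) else 0)" for l by (auto simp: Q_def coeff_sum)
    have d: "degree Q \<le> \<kappa>" by (rule degree_le) (simp add: c)
    have "Q \<noteq> 0"
    proof
      assume "Q = 0"
      obtain i where "i < 1 + \<kappa>" "x i \<noteq> 0" using x(1) by blast
      with c[of "\<kappa> - i"] \<open>Q = 0\<close> show False by simp
    qed
    moreover have "(fps_of_poly Q * F) $ (\<kappa> + j) = 0" if "j < N" for j
      using left_kernel_nth[OF _ d, of x F j] x(2) sum_eq[OF that, of x] that by (simp add: c)
    ultimately show ?r using d by blast
  next
    assume ?r
    then obtain Q where Q: "Q \<noteq> 0" "degree Q \<le> \<kappa>" "\<And>j. j < N \<Longrightarrow> (fps_of_poly Q * F) $ (\<kappa> + j) = 0" by blast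
    let ?x = "\<lambda>i. coeff Q (\<kappa> - i)"
    show ?l
    proof (rule left_kernel_imp_rank_deficient[OF M])
      show "\<exists>i<1 + \<kappa>. ?x i \<noteq> 0"
        by (rule exI[of _ "\<kappa> - degree Q"]) (use Q in simp)
      fix j assume "j < N"
      with Q show "(\<Sum>i<1 + \<kappa>. ?x i * ?M $$ (i, j)) = 0"
        using left_kernel_nth[of \<kappa> ?x Q F j] sum_eq[of j ?x] by simp
    qed
  qed
qed

section \<open>Rational solutions from approximants\<close>

lemma mahler_clear_denominators:
  fixes a :: "nat \<Rightarrow> complex poly"
  assumes k: "k \<ge> 2" and mahler: "(\<Sum>i\<le>d. fps_of_poly (a i) * stretch (k ^ i) F) = 0"
  shows "(\<Sum>i\<le>d. fps_of_poly (a i) * stretch (k ^ i) (fps_of_poly Q * F) * (\<Prod>j\<in>{..d} - {i}. stretch (k ^ j) (fps_of_poly Q))) = 0"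
proof -
  have k0: "k > 0" using k by simp
  then have kp: "k ^ i > 0" for i by simp
  have t: "stretch (k ^ i) (fps_of_poly Q * F) * (\<Prod>j\<in>{..d} - {i}. stretch (k ^ j) (fps_of_poly Q))
      = (\<Prod>j\<le>d. stretch (k ^ j) (fps_of_poly Q)) * stretch (k ^ i) F" if "i \<le> d" for i
    using k0 that by (subst prod.remove[of "{..d}" i]) (simp_all add: mult_ac)
  have "(\<Sum>i\<le>d. fps_of_poly (a i) * stretch (k ^ i) (fps_of_poly Q * F) * (\<Prod>j\<in>{..d} - {i}. stretch (k ^ j) (fps_of_poly Q)))
      = (\<Prod>j\<le>d. stretch (k ^ j) (fps_of_poly Q)) * (\<Sum>i\<le>d. fps_of_poly (a i) * stretch (k ^ i) F)"
    unfolding sum_distrib_left by (rule sum.cong[OF refl]) (use t in \<open>simp add: mult_ac\<close>)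
  then show ?thesis using mahler by simp
qed

lemma degree_prod_poly_stretch_le:
  assumes "finite A" "degree Q \<le> s"
  shows "degree (\<Prod>j\<in>A. poly_stretch (k ^ j) Q) \<le> s * (\<Sum>j\<in>A. k ^ j)"
proof -
  have "degree (\<Prod>j\<in>A. poly_stretch (k ^ j) Q) \<le> (\<Sum>j\<in>A. degree (poly_stretch (k ^ j) Q))"
    by (rule degree_prod_sum_le[OF assms(1), unfolded o_def])
  also have "\<dots> \<le> (\<Sum>j\<in>A. s * k ^ j)"
    using assms(2) by (intro sum_mono) (simp add: mult.commute)
  finally show ?thesis by (simp add: sum_distrib_left)
qed

lemma subdegree_stretch:
  assumes N: "N > 0" and f: "f \<noteq> 0" shows "subdegree (stretch N f) = N * subdegree f"
proof (rule subdegreeI)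
  show "stretch N f $ (N * subdegree f) \<noteq> 0" unfolding stretch_nth[OF N] using N f by simp
  fix l assume l: "l < N * subdegree f"
  show "stretch N f $ l = 0"
  proof (cases "N dvd l")
    case True
    then obtain n where n: "l = N * n" by (rule dvdE)
    with l have "n < subdegree f" by simp
    then have "f $ n = 0" by (rule nth_less_subdegree_zero)
    then show ?thesis unfolding stretch_nth[OF N] n using N by simp
  next
    case False
    then show ?thesis unfolding stretch_nth[OF N] by simp
  qed
qed

text \<open>With \<open>G/Q\<close> of order \<open>e > H\<close>, the term of the equation with the least index \<open>i\<^sub>0\<close> for which \<open>a i\<^sub>0 \<noteq> 0\<close> has
  order at most \<open>H + k\<^bsup>i\<^sub>0\<^esup> e\<close>, up to the common summand \<open>V\<close>. The other terms have order at least
  \<open>k\<^bsup>i\<^sub>0+1\<^esup> e\<close>, which is larger, so the first term cannot be cancelled.\<close>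

lemma mahler_high_order_zero:
  fixes a :: "nat \<Rightarrow> complex poly" and G :: "complex fps"
  assumes k: "k \<ge> 2" and ad: "a d \<noteq> 0" and H: "\<And>i. i \<le> d \<Longrightarrow> degree (a i) \<le> H"
    and Q: "Q \<noteq> 0" "degree Q \<le> s"
    and G: "\<And>l. l < s + H + 1 \<Longrightarrow> G $ l = 0"
    and rel: "(\<Sum>i\<le>d. fps_of_poly (a i) * stretch (k ^ i) G * (\<Prod>j\<in>{..d} - {i}. stretch (k ^ j) (fps_of_poly Q))) = 0"
  shows "G = 0"
proof (rule ccontr)
  assume G0: "G \<noteq> 0"
  have k0: "k > 0" using k by simp
  then have kp: "k ^ i > 0" for i by simp
  have sub_stretch: "subdegree (stretch (k ^ i) f) = k ^ i * subdegree f" if "f \<noteq> 0" for i f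
    by (rule subdegree_stretch[OF kp that])
  let ?q = "fps_of_poly Q"
  have q0: "?q \<noteq> 0" using Q by simp
  define \<sigma> where "\<sigma> = subdegree ?q"
  define v where "v = subdegree G"
  have "\<sigma> \<le> degree Q" unfolding \<sigma>_def by (rule subdegree_leI) (use Q in simp)
  then have \<sigma>s: "\<sigma> \<le> s" using Q(2) by simp
  have v: "s + H + 1 \<le> v" unfolding v_def using G G0 by (intro subdegree_geI) auto
  define e where "e = v - \<sigma>"
  have e: "v = \<sigma> + e" "H < e" using v \<sigma>s by (auto simp: e_def)
  define T where "T i = fps_of_poly (a i) * stretch (k ^ i) G * (\<Prod>j\<in>{..d} - {i}. stretch (k ^ j) ?q)" for i
  define V where "V = (\<Sum>j\<le>d. k ^ j * \<sigma>)"
  have prod_sub: "subdegree (\<Prod>j\<in>A. stretch (k ^ j) ?q) = (\<Sum>j\<in>A. k ^ j * \<sigma>) \<and> (\<Prod>j\<in>A. stretch (k ^ j) ?q) \<noteq> 0"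
    if "finite A" for A
    using that
  proof (induction A rule: finite_induct)
    case (insert j A)
    have nz: "stretch (k ^ j) ?q \<noteq> 0" unfolding stretch_eq_0_iff[OF kp] by (rule q0)
    have IH: "subdegree (\<Prod>j\<in>A. stretch (k ^ j) ?q) = (\<Sum>j\<in>A. k ^ j * \<sigma>)" "(\<Prod>j\<in>A. stretch (k ^ j) ?q) \<noteq> 0"
      using insert.IH by auto
    have "subdegree (stretch (k ^ j) ?q * (\<Prod>j\<in>A. stretch (k ^ j) ?q)) = k ^ j * \<sigma> + (\<Sum>j\<in>A. k ^ j * \<sigma>)"
      unfolding subdegree_mult[OF nz IH(2)] IH(1) sub_stretch[OF q0] \<sigma>_def ..
    moreover have "stretch (k ^ j) ?q * (\<Prod>j\<in>A. stretch (k ^ j) ?q) \<noteq> 0" using nz IH(2) by (rule no_zero_divisors)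
    ultimately show ?case unfolding prod.insert[OF insert.hyps] sum.insert[OF insert.hyps] by (rule conjI)
  qed simp
  have T: "T i \<noteq> 0 \<and> subdegree (T i) = subdegree (fps_of_poly (a i)) + (k ^ i * e + V)" if i: "i \<le> d" "a i \<noteq> 0" for i
  proof -
    have nz: "fps_of_poly (a i) \<noteq> 0" using i(2) by simp
    have nzG: "stretch (k ^ i) G \<noteq> 0" unfolding stretch_eq_0_iff[OF kp] by (rule G0)
    have V: "V = k ^ i * \<sigma> + (\<Sum>j\<in>{..d} - {i}. k ^ j * \<sigma>)"
      unfolding V_def using i by (intro sum.remove) auto
    have P: "subdegree (\<Prod>j\<in>{..d} - {i}. stretch (k ^ j) ?q) = (\<Sum>j\<in>{..d} - {i}. k ^ j * \<sigma>)"
      "(\<Prod>j\<in>{..d} - {i}. stretch (k ^ j) ?q) \<noteq> 0" using prod_sub[of "{..d} - {i}"] by auto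
    have nz2: "fps_of_poly (a i) * stretch (k ^ i) G \<noteq> 0" using nz nzG by (rule no_zero_divisors)
    have "subdegree (T i) = subdegree (fps_of_poly (a i)) + k ^ i * v + (\<Sum>j\<in>{..d} - {i}. k ^ j * \<sigma>)"
      unfolding T_def subdegree_mult[OF nz2 P(2)] subdegree_mult[OF nz nzG] P(1) sub_stretch[OF G0] v_def ..
    moreover have "T i \<noteq> 0" unfolding T_def using nz2 P(2) by (rule no_zero_divisors)
    ultimately show ?thesis unfolding V e(1) by (simp add: distrib_left)
  qed
  define i0 where "i0 = (LEAST i. a i \<noteq> 0)"
  have i0: "a i0 \<noteq> 0" "i0 \<le> d"
    unfolding i0_def by (rule LeastI[of "\<lambda>i. a i \<noteq> 0", OF ad]) (rule Least_le[of "\<lambda>i. a i \<noteq> 0", OF ad])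
  have below: "a i = 0" if "i < i0" for i using not_less_Least that unfolding i0_def by blast
  define \<mu> where "\<mu> = subdegree (T i0)"
  have "subdegree (fps_of_poly (a i0)) \<le> degree (a i0)" by (rule subdegree_leI) (use i0 in simp)
  with H[OF i0(2)] e(2) T[OF i0(2,1)] have \<mu>: "\<mu> < k ^ i0 * e + e + V" unfolding \<mu>_def by linarith
  have other: "T i $ \<mu> = 0" if i: "i \<in> {..d} - {i0}" for i
  proof (cases "a i = 0")
    case False
    with i below have "i0 < i" "i \<le> d" using linorder_neqE_nat by auto
    then have "k ^ Suc i0 \<le> k ^ i" using k by (intro power_increasing) auto
    moreover have "2 * k ^ i0 \<le> k ^ Suc i0" using k by simp
    moreover have "1 \<le> k ^ i0" using kp[of i0] by linarith
    ultimately have "k ^ i0 + 1 \<le> k ^ i" by linarith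
    then have "(k ^ i0 + 1) * e \<le> k ^ i * e" by (rule mult_le_mono1)
    then have "k ^ i0 * e + e \<le> k ^ i * e" by simp
    with \<mu> T[OF \<open>i \<le> d\<close> False] have "\<mu> < subdegree (T i)" by linarith
    then show ?thesis by (rule nth_less_subdegree_zero)
  qed (simp add: T_def)
  have "(\<Sum>i\<le>d. T i) $ \<mu> = 0" using rel by (simp only: T_def fps_zero_nth)
  moreover have "(\<Sum>i\<le>d. T i $ \<mu>) = T i0 $ \<mu> + (\<Sum>i\<in>{..d} - {i0}. T i $ \<mu>)"
    by (rule sum.remove) (use i0 in auto)
  moreover have "(\<Sum>i\<in>{..d} - {i0}. T i $ \<mu>) = 0"
    by (rule sum.neutral) (use other in blast)
  ultimately have "T i0 $ \<mu> = 0" by (simp only: fps_sum_nth add_0_right)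
  then show False using T[OF i0(2,1)] unfolding \<mu>_def by (metis nth_subdegree_nonzero)
qed

text \<open>The polynomial \<open>T\<close> is the functional equation for \<open>P/Q\<close> with denominators cleared. Its degree is less than
  \<open>N\<close>, while the equation for \<open>F\<close> expresses it through \<open>G = Q F - P\<close>, whose coefficients vanish below \<open>N\<close>.\<close>

lemma approximant_is_exact:
  fixes a :: "nat \<Rightarrow> complex poly"
  assumes k: "k \<ge> 2" and ad: "a d \<noteq> 0" and H: "\<And>i. i \<le> d \<Longrightarrow> degree (a i) \<le> H"
    and mahler: "(\<Sum>i\<le>d. fps_of_poly (a i) * stretch (k ^ i) F) = 0"
    and Q: "Q \<noteq> 0" "degree Q \<le> \<kappa>"
    and N: "N = 1 + H + \<kappa> * (\<Sum>i\<le>d. k ^ i)"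
    and van: "\<And>j. j < N \<Longrightarrow> (fps_of_poly Q * F) $ (\<kappa> + j) = 0"
  shows "\<exists>P. fps_of_poly Q * F = fps_of_poly P"
proof -
  have k0: "k > 0" using k by simp
  then have kp: "k ^ i > 0" for i by simp
  let ?q = "fps_of_poly Q"
  define P where "P = (\<Sum>l<\<kappa>. monom ((?q * F) $ l) l)"
  have cP: "coeff P l = (if l < \<kappa> then (?q * F) $ l else 0)" for l by (auto simp: P_def coeff_sum)
  have dP: "degree P \<le> \<kappa>" by (rule degree_le) (simp add: cP)
  define G where "G = ?q * F - fps_of_poly P"
  have G: "G $ l = 0" if "l < \<kappa> + N" for l
  proof (cases "l < \<kappa>")
    case True
    then show ?thesis by (simp add: G_def cP)
  next
    case False
    then obtain j where l: "l = \<kappa> + j" by (metis le_iff_add not_le)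
    with that have "(?q * F) $ l = 0" using van[of j] by simp
    with False show ?thesis by (simp add: G_def cP)
  qed
  define W where "W i = (\<Prod>j\<in>{..d} - {i}. stretch (k ^ j) ?q)" for i
  define T where "T = (\<Sum>i\<le>d. a i * poly_stretch (k ^ i) P * (\<Prod>j\<in>{..d} - {i}. poly_stretch (k ^ j) Q))"
  have qF: "?q * F = fps_of_poly P + G" by (simp add: G_def)
  have W: "W i = fps_of_poly (\<Prod>j\<in>{..d} - {i}. poly_stretch (k ^ j) Q)" for i
    using k0 by (simp add: W_def fps_of_poly_prod)
  have split: "fps_of_poly (a i) * stretch (k ^ i) (?q * F) * W i
      = fps_of_poly (a i * poly_stretch (k ^ i) P * (\<Prod>j\<in>{..d} - {i}. poly_stretch (k ^ j) Q))
        + fps_of_poly (a i) * stretch (k ^ i) G * W i" for i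
    unfolding qF W fps_of_poly_mult stretch_simps(1)[OF kp] stretch_simps(7)[OF kp] by (simp only: distrib_left distrib_right)
  have "(\<Sum>i\<le>d. fps_of_poly (a i) * stretch (k ^ i) (?q * F) * W i) = 0"
    using mahler_clear_denominators[OF k mahler, of Q] by (simp only: W_def)
  then have "fps_of_poly T + (\<Sum>i\<le>d. fps_of_poly (a i) * stretch (k ^ i) G * W i) = 0"
    unfolding split sum.distrib T_def fps_of_poly_sum .
  then have rel: "fps_of_poly T = - (\<Sum>i\<le>d. fps_of_poly (a i) * stretch (k ^ i) G * W i)"
    by (simp only: eq_neg_iff_add_eq_0)
  have sigG: "stretch (k ^ i) G $ l = 0" if "l < N" for i l
  proof -
    have "l div k ^ i \<le> l" by (rule div_le_dividend)
    with that have "l div k ^ i < \<kappa> + N" by linarith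
    then show ?thesis using G k0 by (simp add: stretch_nth)
  qed
  have "T = 0"
  proof (rule poly_eqI)
    fix l
    show "coeff T l = coeff 0 l"
    proof (cases "l < N")
      case True
      have 0: "(fps_of_poly (a i) * stretch (k ^ i) G * W i) $ l = 0" for i
      proof -
        have "(stretch (k ^ i) G * (fps_of_poly (a i) * W i)) $ l = 0"
          unfolding fps_mult_nth by (rule sum.neutral) (use sigG True in auto)
        then show ?thesis by (simp only: mult_ac)
      qed
      have "coeff T l = fps_of_poly T $ l" by simp
      also have "\<dots> = - (\<Sum>i\<le>d. (fps_of_poly (a i) * stretch (k ^ i) G * W i) $ l)"
        unfolding rel by (simp only: fps_neg_nth fps_sum_nth)
      also have "\<dots> = 0" by (simp only: 0 sum.neutral_const neg_0_equal_iff_equal minus_zero)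
      finally show ?thesis by simp
    next
      case False
      have "degree T \<le> H + \<kappa> * (\<Sum>i\<le>d. k ^ i)"
        unfolding T_def
      proof (rule degree_sum_le)
        fix i assume "i \<in> {..d}"
        then have i: "i \<le> d" by simp
        let ?R = "\<Prod>j\<in>{..d} - {i}. poly_stretch (k ^ j) Q"
        have "degree (a i * poly_stretch (k ^ i) P) \<le> degree (a i) + k ^ i * degree P"
          using degree_mult_le[of "a i" "poly_stretch (k ^ i) P"] by simp
        moreover have "k ^ i * degree P \<le> \<kappa> * k ^ i" using dP by (simp add: mult.commute)
        moreover have "degree ?R \<le> \<kappa> * (\<Sum>j\<in>{..d} - {i}. k ^ j)"
          by (rule degree_prod_poly_stretch_le) (use Q(2) in simp_all)
        moreover have "degree (a i * poly_stretch (k ^ i) P * ?R) \<le> degree (a i * poly_stretch (k ^ i) P) + degree ?R"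
          by (rule degree_mult_le)
        moreover have "\<kappa> * (\<Sum>j\<le>d. k ^ j) = \<kappa> * k ^ i + \<kappa> * (\<Sum>j\<in>{..d} - {i}. k ^ j)"
          unfolding distrib_left[symmetric] by (rule arg_cong[OF sum.remove]) (use i in auto)
        ultimately show "degree (a i * poly_stretch (k ^ i) P * ?R) \<le> H + \<kappa> * (\<Sum>j\<le>d. k ^ j)"
          using H[OF i] by linarith
      qed simp
      with False N show ?thesis by (simp add: coeff_eq_0)
    qed
  qed
  then have "(\<Sum>i\<le>d. fps_of_poly (a i) * stretch (k ^ i) G * W i) = 0" using rel by simp
  then have "G = 0"
    unfolding W_def
  proof (rule mahler_high_order_zero[where a = a and H = H and s = \<kappa> and Q = Q, rotated -1])
    show "G $ l = 0" if "l < \<kappa> + H + 1" for l using G N that by simp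
  qed (fact k ad Q H)+
  then show ?thesis by (auto simp: G_def)
qed

section \<open>Degrees of a rational solution\<close>

lemma poly_stretch_simps:
  "poly_stretch N (p + q) = poly_stretch N p + poly_stretch N q" "poly_stretch N (p * q) = poly_stretch N p * poly_stretch N q"
  by (simp_all add: poly_stretch_def pcompose_add pcompose_mult)

lemma coprime_poly_stretch:
  assumes "coprime p q" shows "coprime (poly_stretch N p) (poly_stretch N q)"
proof -
  obtain u v where "u * p + v * q = gcd p q" using bezout_coefficients_fst_snd[of p q] by blast
  with assms have "u * p + v * q = 1" by simp
  then have "poly_stretch N u * poly_stretch N p + poly_stretch N v * poly_stretch N q = 1"
    by (metis poly_stretch_simps poly_stretch_1)
  then show ?thesis by (intro coprimeI) (metis dvd_add dvd_mult)
qed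

lemma geometric_sum_nat: "(k - 1) * (\<Sum>i<n. k ^ i) = k ^ n - (1 :: nat)" if "k \<ge> 1"
proof (induction n)
  case (Suc n)
  have "(k - 1) * (\<Sum>i<Suc n. k ^ i) = (k ^ n - 1) + (k - 1) * k ^ n"
    unfolding sum.lessThan_Suc distrib_left Suc.IH ..
  also have "\<dots> = k ^ Suc n - 1"
    using that by (simp add: diff_mult_distrib)
  finally show ?case .
qed simp

lemma mahler_cross_multiplied:
  fixes a :: "nat \<Rightarrow> complex poly"
  assumes k: "k \<ge> 2" and mahler: "(\<Sum>i\<le>d. fps_of_poly (a i) * stretch (k ^ i) F) = 0"
    and F: "fps_of_poly q * F = fps_of_poly p"
  shows "(\<Sum>i\<le>d. a i * poly_stretch (k ^ i) p * (\<Prod>j\<in>{..d} - {i}. poly_stretch (k ^ j) q)) = 0"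
proof -
  have k0: "k > 0" using k by simp
  have "fps_of_poly (\<Sum>i\<le>d. a i * poly_stretch (k ^ i) p * (\<Prod>j\<in>{..d} - {i}. poly_stretch (k ^ j) q)) = 0"
    using mahler_clear_denominators[OF k mahler, of q] k0
    unfolding F by (simp add: fps_of_poly_sum fps_of_poly_prod fps_of_poly_mult)
  then show ?thesis by simp
qed

text \<open>All terms with \<open>i < d\<close> have the factor \<open>poly_stretch (k ^ d) q\<close>, so it divides the last term, where it is
  coprime to \<open>poly_stretch (k ^ d) p\<close>.\<close>

lemma denominator_degree_bound:
  fixes a :: "nat \<Rightarrow> complex poly"
  assumes k: "k \<ge> 2" and ad: "a d \<noteq> 0" and H: "\<And>i. i \<le> d \<Longrightarrow> degree (a i) \<le> H"
    and q: "q \<noteq> 0" and cop: "coprime p q"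
    and rel: "(\<Sum>i\<le>d. a i * poly_stretch (k ^ i) p * (\<Prod>j\<in>{..d} - {i}. poly_stretch (k ^ j) q)) = 0"
  shows "k ^ d * degree q \<le> H + degree q * (\<Sum>j<d. k ^ j)"
proof -
  have k0: "k > 0" using k by simp
  let ?b = "poly_stretch (k ^ d) q" and ?R = "\<Prod>j<d. poly_stretch (k ^ j) q"
  let ?S = "\<Sum>i<d. a i * poly_stretch (k ^ i) p * (\<Prod>j\<in>{..d} - {i}. poly_stretch (k ^ j) q)"
  have "?b dvd ?S"
  proof (rule dvd_sum)
    fix i assume "i \<in> {..<d}"
    then have "?b dvd (\<Prod>j\<in>{..d} - {i}. poly_stretch (k ^ j) q)" by (intro dvd_prodI) auto
    then show "?b dvd a i * poly_stretch (k ^ i) p * (\<Prod>j\<in>{..d} - {i}. poly_stretch (k ^ j) q)" by (rule dvd_mult)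
  qed
  moreover have "?S + a d * poly_stretch (k ^ d) p * (\<Prod>j\<in>{..d} - {d}. poly_stretch (k ^ j) q) = 0"
    using rel unfolding lessThan_Suc_atMost[symmetric] sum.lessThan_Suc .
  moreover have "{..d} - {d} = {..<d}" by auto
  ultimately have "a d * poly_stretch (k ^ d) p * ?R = - ?S" by (simp only: eq_neg_iff_add_eq_0 add.commute)
  with \<open>?b dvd ?S\<close> have "?b dvd a d * poly_stretch (k ^ d) p * ?R" by (simp only: dvd_minus_iff)
  then have "?b dvd poly_stretch (k ^ d) p * (a d * ?R)" by (simp add: mult_ac)
  moreover have "coprime ?b (poly_stretch (k ^ d) p)" using coprime_poly_stretch[OF cop] by (simp add: coprime_commute)
  ultimately have "?b dvd a d * ?R" using coprime_dvd_mult_right_iff by blast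
  moreover have "a d * ?R \<noteq> 0" using ad q k0 by simp
  ultimately have "degree ?b \<le> degree (a d * ?R)" by (rule dvd_imp_degree_le)
  moreover have "degree (a d * ?R) \<le> degree (a d) + degree ?R" by (rule degree_mult_le)
  moreover have "degree (a d) \<le> H" by (rule H) simp
  moreover have "degree ?R \<le> degree q * (\<Sum>j<d. k ^ j)" by (rule degree_prod_poly_stretch_le) simp_all
  ultimately show ?thesis unfolding degree_poly_stretch by linarith
qed

text \<open>If \<open>e\<close> were larger, the last term would have a degree larger than that of all other terms.\<close>

lemma numerator_degree_bound:
  fixes a :: "nat \<Rightarrow> complex poly"
  assumes k: "k \<ge> 2" and d: "d \<ge> 1" and ad: "a d \<noteq> 0" and H: "\<And>i. i \<le> d \<Longrightarrow> degree (a i) \<le> H"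
    and q: "q \<noteq> 0" and p: "p \<noteq> 0" and e: "degree p = degree q + e"
    and rel: "(\<Sum>i\<le>d. a i * poly_stretch (k ^ i) p * (\<Prod>j\<in>{..d} - {i}. poly_stretch (k ^ j) q)) = 0"
  shows "e * (k ^ (d - 1) * (k - 1)) \<le> H"
proof (rule ccontr)
  assume "\<not> e * (k ^ (d - 1) * (k - 1)) \<le> H"
  then have gap: "H < e * (k ^ (d - 1) * (k - 1))" by simp
  have k0: "k > 0" using k by simp
  define T where "T i = a i * poly_stretch (k ^ i) p * (\<Prod>j\<in>{..d} - {i}. poly_stretch (k ^ j) q)" for i
  define V where "V = (\<Sum>j\<le>d. k ^ j * degree q)"
  have dT: "degree (T i) = degree (a i) + (k ^ i * e + V)" if "i \<le> d" "a i \<noteq> 0" for i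
  proof -
    have V: "V = k ^ i * degree q + (\<Sum>j\<in>{..d} - {i}. k ^ j * degree q)"
      unfolding V_def by (rule sum.remove) (use that in auto)
    have "degree (\<Prod>j\<in>{..d} - {i}. poly_stretch (k ^ j) q) = (\<Sum>j\<in>{..d} - {i}. k ^ j * degree q)"
      using q k0 by (subst degree_prod_sum_eq) auto
    moreover have "(\<Prod>j\<in>{..d} - {i}. poly_stretch (k ^ j) q) \<noteq> 0" using q k0 by simp
    moreover have "poly_stretch (k ^ i) p \<noteq> 0" using p k0 by simp
    ultimately show ?thesis
      using that(2) unfolding V T_def by (simp add: degree_mult_eq e distrib_left)
  qed
  have step: "k ^ d = k ^ (d - 1) * (k - 1) + k ^ (d - 1)"
    using d k0 by (cases d) (simp_all add: diff_mult_distrib2 mult.commute)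
  have less: "degree (T i) < degree (T d)" if i: "i < d" "a i \<noteq> 0" for i
  proof -
    have "k ^ i \<le> k ^ (d - 1)" using i k by (intro power_increasing) auto
    then have "k ^ i * e \<le> k ^ (d - 1) * e" by (rule mult_le_mono1)
    moreover have "k ^ d * e = e * (k ^ (d - 1) * (k - 1)) + k ^ (d - 1) * e"
      unfolding step by (simp add: distrib_left mult.commute)
    moreover have "degree (T i) = degree (a i) + (k ^ i * e + V)" using i by (intro dT) auto
    moreover have "degree (T d) = degree (a d) + (k ^ d * e + V)" using ad by (intro dT) auto
    moreover have "degree (a i) \<le> H" using i by (intro H) auto
    ultimately show ?thesis using gap by linarith
  qed
  have pos: "0 < degree (T d)"
  proof -
    have "e \<noteq> 0"
    proof
      assume "e = 0"
      with gap show False by simp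
    qed
    then have "0 < k ^ d * e" using k0 by simp
    moreover have "degree (T d) = degree (a d) + (k ^ d * e + V)" using ad by (intro dT) auto
    ultimately show ?thesis by linarith
  qed
  have "degree (\<Sum>i<d. T i) < degree (T d)"
  proof (rule degree_sum_less)
    fix i assume "i \<in> {..<d}"
    then show "degree (T i) < degree (T d)"
      using less[of i] pos by (cases "a i = 0") (auto simp: T_def)
  qed (rule pos)
  moreover have "(\<Sum>i<d. T i) + T d = 0"
    using rel unfolding T_def lessThan_Suc_atMost[symmetric] sum.lessThan_Suc .
  then have "(\<Sum>i<d. T i) = - T d" by (simp only: eq_neg_iff_add_eq_0)
  ultimately show False by simp
qed

lemma rational_lowest_terms_degrees:
  fixes a :: "nat \<Rightarrow> complex poly"
  assumes k: "k \<ge> 2" and d: "d \<ge> 1" and ad: "a d \<noteq> 0" and H: "\<And>i. i \<le> d \<Longrightarrow> degree (a i) \<le> H"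
    and mahler: "(\<Sum>i\<le>d. fps_of_poly (a i) * stretch (k ^ i) F) = 0"
    and D: "D \<noteq> 0" "fps_of_poly D * F = fps_of_poly r"
  shows "\<exists>p q. q \<noteq> 0 \<and> fps_of_poly q * F = fps_of_poly p \<and>
    degree q \<le> mahler_kappa k d H \<and> degree p < mahler_kappa k d H"
proof -
  define g where "g = gcd D r"
  have g: "g \<noteq> 0" using D(1) by (simp add: g_def)
  then obtain q p where qp: "D = q * g" "r = p * g" "coprime q p"
    unfolding g_def using gcd_coprime_exists by metis
  have q: "q \<noteq> 0" using qp(1) D(1) by auto
  have "fps_of_poly g * (fps_of_poly q * F) = fps_of_poly g * fps_of_poly p"
    using D(2) unfolding qp(1,2) fps_of_poly_mult by (simp only: mult_ac)
  moreover have "fps_of_poly g \<noteq> 0" using g by simp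
  ultimately have F: "fps_of_poly q * F = fps_of_poly p" by simp
  note rel = mahler_cross_multiplied[OF k mahler F]
  define A where "A = real H * (real k - 1) / (real k ^ (d + 1) - 2 * real k ^ d + 1)"
  define B where "B = real H / (real k ^ (d - 1) * (real k - 1))"
  define \<alpha> where "\<alpha> = \<lfloor>A\<rfloor>"
  define \<beta> where "\<beta> = \<lfloor>B\<rfloor>"
  have k1: "real (k - 1) = real k - 1" using k by simp
  have kd: "real (k ^ d - 1) = real k ^ d - 1" using k by (simp add: of_nat_diff)
  have Bpos: "0 < real k ^ (d - 1) * (real k - 1)" using k by simp
  have "real k ^ (d + 1) - 2 * real k ^ d = real k ^ d * (real k - 2)" by (simp add: algebra_simps)
  also have "\<dots> \<ge> 0" using k by simp
  finally have Apos: "0 < real k ^ (d + 1) - 2 * real k ^ d + 1" by simp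
  have dq: "real (degree q) \<le> A"
  proof -
    have "k ^ d * degree q \<le> H + degree q * (\<Sum>j<d. k ^ j)"
      by (rule denominator_degree_bound[OF k ad H q coprime_commute[THEN iffD1, OF qp(3)] rel])
    then have "(k - 1) * (k ^ d * degree q) \<le> (k - 1) * (H + degree q * (\<Sum>j<d. k ^ j))"
      by (rule mult_le_mono2)
    also have "\<dots> = (k - 1) * H + degree q * (k ^ d - 1)"
      using geometric_sum_nat[of k d] k by (simp add: distrib_left mult.left_commute)
    finally have "real ((k - 1) * (k ^ d * degree q)) \<le> real ((k - 1) * H + degree q * (k ^ d - 1))"
      by (rule of_nat_mono)
    then have "(real k - 1) * (real k ^ d * real (degree q)) \<le> (real k - 1) * real H + real (degree q) * (real k ^ d - 1)"
      by (simp only: of_nat_mult of_nat_add of_nat_power kd k1)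
    then have "real (degree q) * (real k ^ (d + 1) - 2 * real k ^ d + 1) \<le> real H * (real k - 1)"
      by (simp add: algebra_simps)
    then show ?thesis unfolding A_def pos_le_divide_eq[OF Apos] .
  qed
  then have fA: "int (degree q) \<le> \<alpha>" unfolding \<alpha>_def by (simp add: le_floor_iff)
  have "0 \<le> B" unfolding B_def using Bpos by simp
  then have fB0: "0 \<le> \<beta>" unfolding \<beta>_def by simp
  have fB: "int (degree p) - int (degree q) \<le> \<beta>"
  proof (cases "p = 0 \<or> degree p \<le> degree q")
    case True
    then have "int (degree p) - int (degree q) \<le> 0" by auto
    with fB0 show ?thesis by linarith
  next
    case False
    then have "degree q \<le> degree p" by linarith
    then obtain e where e: "degree p = degree q + e" by (rule less_eqE)
    have "e * (k ^ (d - 1) * (k - 1)) \<le> H"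
      by (rule numerator_degree_bound[OF k d ad H q _ e rel]) (use False in auto)
    then have "real (e * (k ^ (d - 1) * (k - 1))) \<le> real H" by (rule of_nat_mono)
    then have "real e * (real k ^ (d - 1) * (real k - 1)) \<le> real H"
      by (simp only: of_nat_mult of_nat_power k1)
    then have "real e \<le> B" unfolding B_def by (simp only: pos_le_divide_eq[OF Bpos])
    then have "int e \<le> \<beta>" unfolding \<beta>_def by (simp add: le_floor_iff)
    with e show ?thesis by simp
  qed
  have \<kappa>: "int (mahler_kappa k d H) = \<alpha> + \<beta> + 1"
  proof -
    have "0 \<le> \<alpha> + \<beta> + 1" using fA fB0 by linarith
    then show ?thesis unfolding mahler_kappa_def \<alpha>_def \<beta>_def A_def B_def by (rule nat_0_le)
  qed
  have "degree q \<le> mahler_kappa k d H" "degree p < mahler_kappa k d H"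
    using \<kappa> fA fB fB0 by linarith+
  with q F show ?thesis by (intro exI[of _ p] exI[of _ q] conjI)
qed

section \<open>Algebraicity over the rational functions\<close>

lemma fps_to_fls_mult: "fps_to_fls (f * g) = fps_to_fls f * fps_to_fls (g :: complex fps)"
  by (simp add: fls_times_fps_to_fls)

lemma fps_to_fls_sum: "fps_to_fls (sum f A) = (\<Sum>x\<in>A. fps_to_fls (f x :: complex fps))"
  by (induction A rule: infinite_finite_induct) auto

text \<open>Clearing the denominators of the coefficients.\<close>

lemma algebraic_imp_bipoly_eval:
  assumes "algebraic_over rational_fls (fps_to_fls F)"
  shows "\<exists>R. R \<noteq> 0 \<and> bipoly_eval R F = 0"
proof -
  obtain P where P: "P \<noteq> 0" "\<And>i. coeff P i \<in> rational_fls" "poly P (fps_to_fls F) = 0"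
    using assms unfolding algebraic_over_def by auto
  let ?\<phi> = "\<lambda>p. fps_to_fls (fps_of_poly p) :: complex fls"
  have "\<forall>i. \<exists>p q. coeff P i = ?\<phi> p / ?\<phi> q \<and> q \<noteq> 0"
    using P(2) unfolding rational_fls_def by blast
  then obtain p q where pq: "\<And>i. coeff P i = ?\<phi> (p i) / ?\<phi> (q i)" "\<And>i. q i \<noteq> 0" by metis
  let ?n = "degree P"
  define Q where "Q = (\<Prod>i\<le>?n. q i)"
  define c where "c i = p i * (\<Prod>j\<in>{..?n} - {i}. q j)" for i
  have c: "?\<phi> (c i) = ?\<phi> Q * coeff P i" if "i \<le> ?n" for i
  proof -
    have "Q = q i * (\<Prod>j\<in>{..?n} - {i}. q j)"
      unfolding Q_def by (rule prod.remove) (use that in auto)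
    moreover have "?\<phi> (q i) \<noteq> 0" using pq(2) by simp
    ultimately show ?thesis
      by (simp add: c_def pq(1)[of i] fps_of_poly_mult fps_to_fls_mult field_simps)
  qed
  define R where "R = (\<Sum>i\<le>?n. monom (c i) i)"
  have cR: "coeff R i = (if i \<le> ?n then c i else 0)" for i by (auto simp: R_def coeff_sum)
  have dR: "degree R \<le> ?n" by (rule degree_le) (simp add: cR)
  have Q0: "?\<phi> Q \<noteq> 0" using pq(2) by (simp add: Q_def)
  have "fps_to_fls (bipoly_eval R F) = (\<Sum>i\<le>?n. ?\<phi> (c i) * fps_to_fls F ^ i)"
    unfolding bipoly_eval_altdef[OF dR] fps_to_fls_sum
    by (rule sum.cong) (auto simp: cR fps_to_fls_mult fps_to_fls_power)
  also have "\<dots> = ?\<phi> Q * poly P (fps_to_fls F)"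
    unfolding poly_altdef sum_distrib_left by (rule sum.cong) (auto simp: c mult.assoc)
  also have "\<dots> = 0" using P(3) by simp
  finally have "bipoly_eval R F = 0" by simp
  moreover have "R \<noteq> 0"
  proof
    assume "R = 0"
    then have "c ?n = 0" using cR[of ?n] by simp
    then have "?\<phi> Q * coeff P ?n = 0" using c[of ?n] by simp
    with Q0 P(1) show False by simp
  qed
  ultimately show ?thesis by blast
qed

section \<open>The transcendence test\<close>

theorem mainTheorem2:
  fixes k d H \<kappa> :: nat
    and F :: "complex fps"
    and a :: "nat \<Rightarrow> complex poly"
    and M :: "complex mat"
  assumes "k \<ge> 2" and "d \<ge> 1"
    and "mahler_function k F"
    and "mahler_equation k d a F"
    and "a d \<noteq> 0"
    and "H = Max ((\<lambda>i. degree (a i)) ` {0..d})"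
    and "\<kappa> = mahler_kappa k d H"
    and "M = hankel_mat (1 + \<kappa>) (1 + H + \<kappa> * ((k ^ (d + 1) - 1) div (k - 1))) F"
  shows "(vec_space.rank (1 + \<kappa>) M = 1 + \<kappa> \<longrightarrow>
            transcendental_over rational_fls (fps_to_fls F)) \<and>
         (vec_space.rank (1 + \<kappa>) M \<noteq> 1 + \<kappa> \<longrightarrow> fps_to_fls F \<in> rational_fls)"
proof -
  have k: "k \<ge> 2" and d: "d \<ge> 1" and ad: "a d \<noteq> 0" by fact+
  have mahler: "(\<Sum>i\<le>d. fps_of_poly (a i) * stretch (k ^ i) F) = 0"
    using assms(4) by (simp only: mahler_equation_def stretch_def atLeast0AtMost)
  have H: "degree (a i) \<le> H" if "i \<le> d" for i
    unfolding assms(6) by (rule Max_ge) (use that in auto)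
  define N where "N = 1 + H + \<kappa> * ((k ^ (d + 1) - 1) div (k - 1))"
  have "k ^ (d + 1) - 1 = (k - 1) * (\<Sum>i\<le>d. k ^ i)"
    using geometric_sum_nat[of k "Suc d"] k unfolding lessThan_Suc_atMost by simp
  moreover have "k - 1 \<noteq> 0" using k by simp
  then have "(k - 1) * (\<Sum>i\<le>d. k ^ i) div (k - 1) = (\<Sum>i\<le>d. k ^ i)"
    by (rule nonzero_mult_div_cancel_left)
  ultimately have "(k ^ (d + 1) - 1) div (k - 1) = (\<Sum>i\<le>d. k ^ i)" by (simp only:)
  then have N: "N = 1 + H + \<kappa> * (\<Sum>i\<le>d. k ^ i)" by (simp add: N_def)
  have rank: "vec_space.rank (1 + \<kappa>) M \<noteq> 1 + \<kappa> \<longleftrightarrow>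
      (\<exists>Q. Q \<noteq> 0 \<and> degree Q \<le> \<kappa> \<and> (\<forall>j<N. (fps_of_poly Q * F) $ (\<kappa> + j) = 0))"
    unfolding assms(8) N_def by (rule hankel_rank_deficient_iff)
  show ?thesis
  proof (intro conjI impI)
    assume full: "vec_space.rank (1 + \<kappa>) M = 1 + \<kappa>"
    show "transcendental_over rational_fls (fps_to_fls F)"
      unfolding transcendental_over_def
    proof
      assume "algebraic_over rational_fls (fps_to_fls F)"
      then have "\<exists>R. R \<noteq> 0 \<and> bipoly_eval R F = 0" by (rule algebraic_imp_bipoly_eval)
      then obtain R where R: "R \<noteq> 0" "bipoly_eval R F = 0" by blast
      obtain D r where D: "D \<noteq> 0" "fps_of_poly D * F = fps_of_poly r"
        using algebraic_mahler_rational[OF k d ad mahler[folded atLeast0AtMost] R] by blast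
      have "\<exists>p q. q \<noteq> 0 \<and> fps_of_poly q * F = fps_of_poly p \<and> degree q \<le> \<kappa> \<and> degree p < \<kappa>"
        unfolding assms(7) by (rule rational_lowest_terms_degrees[OF k d ad H mahler D])
      then obtain p q where pq: "q \<noteq> 0" "fps_of_poly q * F = fps_of_poly p" "degree q \<le> \<kappa>" "degree p < \<kappa>"
        by blast
      have "\<forall>j<N. (fps_of_poly q * F) $ (\<kappa> + j) = 0"
        unfolding pq(2) using pq(4) by (simp add: coeff_eq_0)
      with pq(1,3) have "\<exists>Q. Q \<noteq> 0 \<and> degree Q \<le> \<kappa> \<and> (\<forall>j<N. (fps_of_poly Q * F) $ (\<kappa> + j) = 0)"
        by (intro exI[of _ q] conjI)
      then have "vec_space.rank (1 + \<kappa>) M \<noteq> 1 + \<kappa>" by (rule rank[THEN iffD2])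
      then show False using full by contradiction
    qed
  next
    assume "vec_space.rank (1 + \<kappa>) M \<noteq> 1 + \<kappa>"
    then obtain Q where Q: "Q \<noteq> 0" "degree Q \<le> \<kappa>" "\<And>j. j < N \<Longrightarrow> (fps_of_poly Q * F) $ (\<kappa> + j) = 0"
      using rank by blast
    obtain P where P: "fps_of_poly Q * F = fps_of_poly P"
      using approximant_is_exact[OF k ad H mahler Q(1,2) N Q(3)] by blast
    have "fps_to_fls (fps_of_poly Q) * fps_to_fls F = fps_to_fls (fps_of_poly P)"
      by (simp only: P flip: fps_to_fls_mult)
    moreover have "fps_to_fls (fps_of_poly Q) \<noteq> 0" using Q(1) by simp
    ultimately have "fps_to_fls F = fps_to_fls (fps_of_poly P) / fps_to_fls (fps_of_poly Q)"
      by (simp add: field_simps)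
    then show "fps_to_fls F \<in> rational_fls" unfolding rational_fls_def using Q(1) by blast
  qed
qed

end
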